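(* Let $I$ be a compact interval of $\mathbb{R}$ and let $Y$ be the LMSM with Hurst functional parameter $H(\cdot)$. Assume that $(\mathbf{A'})$: $H(I)\subset(1/\alpha;1)$ and $H(\cdot)\in\mathcal{C}^{\gamma_H}(I)$ for some $\gamma_H\in[0,1)$. Then for every $\omega\in\Omega_0^*\cap\Omega_1^*$ (an event of probability $1$), $$\sup_{(t,s)\in I^2,\ t\neq s}\left\{\frac{|Y(t,\omega)-Y(s,\omega)|}{|t-s|^{\gamma_H\wedge\left(\min_{x\in I}H(x)-1/\alpha\right)}}\right\}<\infty .$$
   Context: Fix $\alpha\in(1,2)$. Let $Z_\alpha(ds)$ be an independently scattered symmetric $\alpha$-stable random measure on $\mathbb{R}$ with Lebesgue control measure, defined on a probability space $(\Omega,\mathcal{F},\mathbb{P})$. For $x\in\mathbb{R}$, $\kappa\in\mathbb{R}$, $(x)_+^\kappa=x^\kappa$ if $x>0$ and $0$ otherwise. Let $\psi$ be a three times continuously differentiable compactly supported Daubechies mother wavelet generating an orthonormal basis of $L^2(\mathbb{R})$. For $(x,v)\in\mathbb{R}\times(1/\alpha;1)$ put $\Psi(x,v)=\int_{\mathbb{R}}(x-s)_+^{v-1/\alpha}\psi(s)\,ds$, and for $(j,k)\in\mathbb{Z}^2$ put $\epsilon_{j,k}=2^{j/\alpha}\int_{\mathbb{R}}\psi(2^js-k)\,Z_\alpha(ds)$. $\Omega_0^*$ denotes an event of probability $1$ such that for every real $\eta>0$ there is a positive finite random variable $C_\eta$ with $|\epsilon_{j,k}(\omega)|\le C_\eta(\omega)(3+|j|)^{1/\alpha+\eta}(3+|k|)^{1/\alpha+\eta}$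 for all $\omega\in\Omega_0^*$ and all $(j,k)\in\mathbb{Z}^2$ (such an event exists). $\Omega_1^*$ denotes an event of probability $1$ such that for every real $l>0$ there is a positive finite random variable $C'_l$ with $|\epsilon_{j,k}(\omega)|\le C'_l(\omega)2^{j/\alpha}$ for all $\omega\in\Omega_1^*$ and all $(j,k)\in\mathbb{Z}_+\times\mathbb{Z}$ with $|k|2^{-j}\le l$ (such an event exists). The field $X=\{X(u,v):(u,v)\in\mathbb{R}\times(1/\alpha;1)\}$, $X(u,v)=\int_{\mathbb{R}}\{(u-s)_+^{v-1/\alpha}-(-s)_+^{v-1/\alpha}\}Z_\alpha(ds)$, is identified with its modification given on $\Omega_0^*$ by the series $X(u,v)=\sum_{(j,k)\in\mathbb{Z}^2}2^{-jv}\epsilon_{j,k}\big(\Psi(2^ju-k,v)-\Psi(-k,v)\big)$, which on $\Omega_0^*$ converges uniformly in $(u,v)$ on compact subsets of $\mathbb{R}\times(1/\alpha;1)$. Given a continuous function $H:\mathbb{R}\to(1/\alpha;1)$, the linear multifractional stable motion (LMSM) is $Y(t)=X(t,H(t))$, $t\in\mathbb{R}$. For a compact interval $I$ and $\gamma\in[0,1)$, $\mathcal{C}^\gamma(I)$ is the set of real continuous functions $f$ on $I$ with $\sup_{x\neq y\in I}|f(x)-f(y)|/|x-y|^\gamma<\infty$. $a\wedge b=\min(a,b)$. *)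

theory Defs
  imports "HOL-Analysis.Analysis"
begin

definition pospow :: "real \<Rightarrow> real \<Rightarrow> real" where
  "pospow x \<kappa> = (if x > 0 then x powr \<kappa> else 0)"

definition C3_fun :: "(real \<Rightarrow> real) \<Rightarrow> bool" where
  "C3_fun f \<longleftrightarrow> (\<exists>d1 d2 d3.
      (\<forall>x. (f has_real_derivative d1 x) (at x)) \<and>
      (\<forall>x. (d1 has_real_derivative d2 x) (at x)) \<and>
      (\<forall>x. (d2 has_real_derivative d3 x) (at x)) \<and>
      continuous_on UNIV d3)"

definition wav :: "(real \<Rightarrow> real) \<Rightarrow> int \<Rightarrow> int \<Rightarrow> real \<Rightarrow> real" where
  "wav \<psi> j k x = 2 powr (real_of_int j / 2) * \<psi> (2 powr real_of_int j * x - real_of_int k)"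

definition smooth_cs_wavelet :: "(real \<Rightarrow> real) \<Rightarrow> bool" where
  "smooth_cs_wavelet \<psi> \<longleftrightarrow>
     C3_fun \<psi> \<and> bounded {x. \<psi> x \<noteq> 0} \<and>
     (\<forall>j k j' k'. integral\<^sup>L lborel (\<lambda>x. wav \<psi> j k x * wav \<psi> j' k' x)
                    = (if (j, k) = (j', k') then 1 else 0)) \<and>
     (\<forall>f. f \<in> borel_measurable lborel \<longrightarrow> integrable lborel (\<lambda>x. (f x)\<^sup>2) \<longrightarrow>
          (\<forall>j k. integral\<^sup>L lborel (\<lambda>x. f x * wav \<psi> j k x) = 0) \<longrightarrow>
          (AE x in lborel. f x = 0))"

definition Psi :: "(real \<Rightarrow> real) \<Rightarrow> real \<Rightarrow> real \<Rightarrow> real \<Rightarrow> real" where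
  "Psi \<psi> \<alpha> x v = integral\<^sup>L lborel (\<lambda>s. pospow (x - s) (v - 1 / \<alpha>) * \<psi> s)"

text \<open>The defining property of Omega_0^* (for a fixed coefficient array e = eps(omega)).\<close>
definition Omega0_prop :: "real \<Rightarrow> (int \<Rightarrow> int \<Rightarrow> real) \<Rightarrow> bool" where
  "Omega0_prop \<alpha> e \<longleftrightarrow> (\<forall>\<eta>>0. \<exists>C>0. \<forall>j k.
      \<bar>e j k\<bar> \<le> C * (3 + \<bar>real_of_int j\<bar>) powr (1 / \<alpha> + \<eta>)
                    * (3 + \<bar>real_of_int k\<bar>) powr (1 / \<alpha> + \<eta>))"

definition Omega1_prop :: "real \<Rightarrow> (int \<Rightarrow> int \<Rightarrow> real) \<Rightarrow> bool" where
  "Omega1_prop \<alpha> e \<longleftrightarrow> (\<forall>l>0. \<exists>C'>0. \<forall>j k. j \<ge> 0 \<longrightarrow>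
      \<bar>real_of_int k\<bar> * 2 powr (- real_of_int j) \<le> l \<longrightarrow>
      \<bar>e j k\<bar> \<le> C' * 2 powr (real_of_int j / \<alpha>))"

definition Xfield :: "(real \<Rightarrow> real) \<Rightarrow> real \<Rightarrow> (int \<Rightarrow> int \<Rightarrow> real) \<Rightarrow> real \<Rightarrow> real \<Rightarrow> real" where
  "Xfield \<psi> \<alpha> e u v = (\<Sum>\<^sub>\<infinity>(j, k) \<in> (UNIV :: (int \<times> int) set).
      2 powr (- real_of_int j * v) * e j k *
      (Psi \<psi> \<alpha> (2 powr real_of_int j * u - real_of_int k) v - Psi \<psi> \<alpha> (- real_of_int k) v))"

definition LMSM :: "(real \<Rightarrow> real) \<Rightarrow> real \<Rightarrow> (int \<Rightarrow> int \<Rightarrow> real) \<Rightarrow> (real \<Rightarrow> real) \<Rightarrow> real \<Rightarrow> real" where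
  "LMSM \<psi> \<alpha> e H t = Xfield \<psi> \<alpha> e t (H t)"

definition holder_on :: "real \<Rightarrow> real set \<Rightarrow> (real \<Rightarrow> real) \<Rightarrow> bool" where
  "holder_on \<gamma> I f \<longleftrightarrow> continuous_on I f \<and>
     (\<exists>C. \<forall>x\<in>I. \<forall>y\<in>I. x \<noteq> y \<longrightarrow> \<bar>f x - f y\<bar> \<le> C * \<bar>x - y\<bar> powr \<gamma>)"

end

theory Submission
  imports Defs
begin

text \<open>
  Smoothness, compact support and orthonormality force the moments of \<psi> of orders 0, 1, 2 to vanish.
  Hence \<Psi>(x,v), its increments in x and its increments in v are smoothings of power kernels whose
  third derivative decays like \<open>1/y\<^sup>2\<close>, and they are all bounded by \<open>(1+\<bar>x\<bar>)\<close> to the power -2.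
  Summing over k, the scale j contributes at most \<open>2^(-j(v-1/\<alpha>)) min 1 (2^j h)\<close> for \<open>j \<ge> 0\<close> to an
  increment of X in u of length h (the fine-scale bound on the coefficients removes the logarithmic loss),
  and an O(h) amount that is summable over \<open>j < 0\<close>; this gives \<open>h^(v-1/\<alpha>)\<close>. In v the series is
  termwise Lipschitz with summable constants, so that
  \<open>\<bar>Y t - Y s\<bar> \<le> C \<bar>t-s\<bar>^(H t - 1/\<alpha>) + C \<bar>H t - H s\<bar>\<close>.
\<close>

section \<open>Vanishing moments\<close>

text \<open>The obstacle is to reach the exact order v - 1/\<alpha> with no loss. Wavelets located
  in a bounded interval have |k| up to the order of 2^j, and there \<open>Omega0_prop\<close> only
  gives (3+j)^\<rho> 2^(j \<rho>) with \<rho> > 1/\<alpha>. \<open>Omega1_prop\<close> gives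
  2^(j/\<alpha>), which turns 2^(-jv) into exactly 2^(-j(v - 1/\<alpha>)).
  \<open>Omega0_prop\<close> remains the control at coarse scales and for remote k. Its growth
  |k|^\<rho> can be taken with \<rho> < 1 because \<alpha> > 1, so decay of order 2 in the smoothed
  kernels leaves something summable over k; three vanishing moments provide it, and these are the
  ones reached by expanding \<psi> with a third-order remainder. The exponent v is kept away from
  both ends of (1/\<alpha>, 1): the distance to 1/\<alpha> makes fine scales summable, the distance
  to 1 coarse ones, where 2^(-jv) grows and only the factor 2^j of an increment compensates it. All
  estimates are absolute, as \<open>Xfield\<close> is an unordered sum. Its terms vanish at u = 0,
  so its summability is itself an instance of the increment bound.\<close>

lemma integrable_mult_compact_support:
  fixes g \<psi> :: "real \<Rightarrow> real"
  assumes "continuous_on UNIV g" "continuous_on UNIV \<psi>" "\<And>x. \<bar>x\<bar> > R \<Longrightarrow> \<psi> x = 0"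
  shows "integrable lborel (\<lambda>s. g s * \<psi> s)"
proof -
  have "integrable lborel (\<lambda>x. indicator {-R..R} x *\<^sub>R (g x * \<psi> x))"
    by (rule borel_integrable_compact)
       (auto intro!: continuous_intros continuous_on_subset[OF assms(1)] continuous_on_subset[OF assms(2)])
  also have "(\<lambda>x. indicator {-R..R} x *\<^sub>R (g x * \<psi> x)) = (\<lambda>s. g s * \<psi> s)"
  proof
    fix x show "indicator {-R..R} x *\<^sub>R (g x * \<psi> x) = g x * \<psi> x"
      using assms(3)[of x] by (cases "\<bar>x\<bar> > R") (auto simp: indicator_def)
  qed
  finally show ?thesis .
qed

lemma integral_mult_le_compact_support:
  fixes g \<psi> :: "real \<Rightarrow> real"
  assumes g: "continuous_on UNIV g" and c: "continuous_on UNIV \<psi>"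
    and supp: "\<And>x. \<bar>x\<bar> > R \<Longrightarrow> \<psi> x = 0"
    and bd: "\<And>s. \<bar>s\<bar> \<le> R \<Longrightarrow> \<bar>g s\<bar> \<le> B"
  shows "\<bar>\<integral>s. g s * \<psi> s \<partial>lborel\<bar> \<le> B * (\<integral>s. \<bar>\<psi> s\<bar> \<partial>lborel)"
proof -
  have i: "integrable lborel (\<lambda>s. \<bar>\<psi> s\<bar>)"
    using integrable_mult_compact_support[OF _ c supp, of "\<lambda>_. 1"] by auto
  have "\<bar>\<integral>s. g s * \<psi> s \<partial>lborel\<bar> \<le> (\<integral>s. \<bar>g s * \<psi> s\<bar> \<partial>lborel)"
    by (rule integral_abs_bound)
  also have "\<dots> \<le> (\<integral>s. B * \<bar>\<psi> s\<bar> \<partial>lborel)"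
  proof (rule integral_mono)
    show "integrable lborel (\<lambda>s. \<bar>g s * \<psi> s\<bar>)"
      using integrable_mult_compact_support[OF g c supp] by simp
    show "integrable lborel (\<lambda>s. B * \<bar>\<psi> s\<bar>)" using i by simp
    fix s show "\<bar>g s * \<psi> s\<bar> \<le> B * \<bar>\<psi> s\<bar>"
      using bd[of s] supp[of s] by (cases "\<bar>s\<bar> \<le> R") (auto simp: abs_mult intro: mult_right_mono)
  qed
  finally show ?thesis by simp
qed

text \<open>The quadratic part is exactly what the moments of orders 0, 1, 2 see. The expansion is
  used twice: on \<open>\<psi>\<close> with unknown moments, to isolate them, and on kernels once
  the moments are zero, to leave only the third derivative. Taylor's factor 1/6 is dropped.\<close>

lemma Maclaurin3_bound:
  fixes g :: "real \<Rightarrow> real"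
  assumes d: "\<And>t. \<bar>t\<bar> \<le> R \<Longrightarrow> (g has_real_derivative g1 t) (at t)"
    "\<And>t. \<bar>t\<bar> \<le> R \<Longrightarrow> (g1 has_real_derivative g2 t) (at t)"
    "\<And>t. \<bar>t\<bar> \<le> R \<Longrightarrow> (g2 has_real_derivative g3 t) (at t)"
    and B: "\<And>t. \<bar>t\<bar> \<le> R \<Longrightarrow> \<bar>g3 t\<bar> \<le> B" and s: "\<bar>s\<bar> \<le> R"
  shows "\<bar>g s - (g 0 + g1 0 * s + g2 0 / 2 * s^2)\<bar> \<le> B * \<bar>s\<bar>^3"
proof -
  define D where "D m = (if m = 0 then g else if m = 1 then g1 else if m = 2 then g2 else g3)" for m :: nat
  have "\<exists>t. \<bar>t\<bar> \<le> \<bar>s\<bar> \<and> g s = (\<Sum>m<3. D m 0 / fact m * s ^ m) + D 3 t / fact 3 * s ^ 3"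
    by (rule Maclaurin_bi_le) (use d s in \<open>auto simp: D_def less_Suc_eq numeral_eq_Suc\<close>)
  then obtain t where t: "\<bar>t\<bar> \<le> \<bar>s\<bar>"
    and e: "g s = (\<Sum>m<3. D m 0 / fact m * s ^ m) + D 3 t / fact 3 * s ^ 3" by auto
  have "g s - (g 0 + g1 0 * s + g2 0 / 2 * s^2) = g3 t / 6 * s^3"
    unfolding e by (simp add: D_def numeral_eq_Suc)
  moreover have "\<bar>g3 t / 6\<bar> \<le> B" using B[of t] t s by auto
  ultimately show ?thesis by (metis abs_ge_zero abs_mult mult_right_mono power_abs zero_le_power)
qed

text \<open>Along the null sequence (1/2)^n the lowest coefficient is the limit of the left side,
  hence zero; dividing by (1/2)^n then exposes the next one.\<close>

lemma quadratic_coeffs_zero_of_cubic_bound: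
  fixes a b c D :: real
  assumes "\<And>n. \<bar>a + b * (1/2)^n + c * ((1/2)^n)^2\<bar> \<le> D * ((1/2)^n)^3"
  shows "a = 0" "b = 0" "c = 0"
proof -
  have l: "(\<lambda>n. (1/2)^n :: real) \<longlonglongrightarrow> 0" by (rule LIMSEQ_realpow_zero) auto
  have "(\<lambda>n. a + b * (1/2)^n + c * ((1/2)^n)^2) \<longlonglongrightarrow> a + b * 0 + c * 0^2"
    by (intro tendsto_intros l)
  moreover have "(\<lambda>n. a + b * (1/2)^n + c * ((1/2)^n)^2) \<longlonglongrightarrow> 0"
  proof (rule Lim_null_comparison)
    show "\<forall>\<^sub>F n in sequentially. norm (a + b * (1/2)^n + c * ((1/2)^n)^2) \<le> D * ((1/2)^n)^3"
      using assms by auto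
    show "(\<lambda>n. D * ((1/2)^n)^3) \<longlonglongrightarrow> 0" using l by (auto intro!: tendsto_eq_intros)
  qed
  ultimately show a: "a = 0" using LIMSEQ_unique by fastforce
  have 1: "\<bar>b + c * (1/2)^n\<bar> \<le> D * ((1/2)^n)^2" for n
  proof -
    define x where "x = (1/2::real)^n"
    have x: "x > 0" by (simp add: x_def)
    have "b * x + c * x^2 = (b + c * x) * x" by (simp add: algebra_simps power2_eq_square)
    then have "\<bar>b + c * x\<bar> * x \<le> (D * x^2) * x"
      using assms[of n] a x by (simp add: x_def[symmetric] abs_mult power2_eq_square power3_eq_cube)
    then have "\<bar>b + c * (1/2)^n\<bar> * (1/2)^n \<le> (D * ((1/2)^n)^2) * (1/2)^n"
      by (simp only: x_def)
    then show ?thesis by (rule mult_right_le_imp_le) simp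
  qed
  have "(\<lambda>n. b + c * (1/2)^n) \<longlonglongrightarrow> b + c * 0"
    by (intro tendsto_intros l)
  moreover have "(\<lambda>n. b + c * (1/2)^n) \<longlonglongrightarrow> 0"
  proof (rule Lim_null_comparison)
    show "\<forall>\<^sub>F n in sequentially. norm (b + c * (1/2)^n) \<le> D * ((1/2)^n)^2"
      using 1 by auto
    show "(\<lambda>n. D * ((1/2)^n)^2) \<longlonglongrightarrow> 0" using l by (auto intro!: tendsto_eq_intros)
  qed
  ultimately show b: "b = 0" using LIMSEQ_unique by fastforce
  have 2: "\<bar>c\<bar> \<le> D * (1/2)^n" for n
  proof -
    have "\<bar>c\<bar> * (1/2)^n \<le> (D * (1/2)^n) * (1/2)^n"
      using 1[of n] b by (simp add: abs_mult power2_eq_square)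
    then show ?thesis by (rule mult_right_le_imp_le) simp
  qed
  have "(\<lambda>n. D * (1/2)^n) \<longlonglongrightarrow> D * 0" by (intro tendsto_intros l)
  then have "\<bar>c\<bar> \<le> 0" using LIMSEQ_le_const[of "\<lambda>n. D * (1/2)^n" 0 "\<bar>c\<bar>"] 2 by auto
  then show "c = 0" by simp
qed

lemma dyadic_floor_tendsto:
  fixes x :: real
  shows "(\<lambda>n. of_int \<lfloor>x * 2^n\<rfloor> * (1/2)^n) \<longlonglongrightarrow> x"
proof (rule LIMSEQ_I)
  fix r :: real assume "r > 0"
  then obtain N where N: "(1/2)^N < r" using real_arch_pow_inv[of r "1/2"] by auto
  have "norm (of_int \<lfloor>x * 2^n\<rfloor> * (1/2)^n - x) < r" if "n \<ge> N" for n
  proof -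
    have "of_int \<lfloor>x * 2^n\<rfloor> * (1/2)^n - x = (of_int \<lfloor>x * 2^n\<rfloor> - x * 2^n) * (1/2)^n"
      by (simp add: algebra_simps power_divide)
    moreover have "\<bar>of_int \<lfloor>x * 2^n\<rfloor> - x * 2^n\<bar> \<le> 1" by linarith
    ultimately have "\<bar>of_int \<lfloor>x * 2^n\<rfloor> * (1/2)^n - x\<bar> \<le> 1 * (1/2)^n"
      by (simp only: abs_mult) (intro mult_mono; simp)
    also have "\<dots> \<le> (1/2)^N" using that by (simp add: power_decreasing)
    finally show ?thesis using N by simp
  qed
  then show "\<exists>N. \<forall>n\<ge>N. norm (of_int \<lfloor>x * 2^n\<rfloor> * (1/2)^n - x) < r" by blast
qed

lemma continuous_dyadic_zero:
  fixes f :: "real \<Rightarrow> real"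
  assumes "continuous_on UNIV f" "\<And>K n. f (of_int K * (1/2)^n) = 0"
  shows "f x = 0"
proof -
  have "isCont f x" using assms(1) by (simp add: continuous_on_eq_continuous_at)
  then have "(\<lambda>n. f (of_int \<lfloor>x * 2^n\<rfloor> * (1/2)^n)) \<longlonglongrightarrow> f x"
    by (rule isCont_tendsto_compose) (rule dyadic_floor_tendsto)
  then show ?thesis using assms(2) LIMSEQ_unique[of "\<lambda>_. 0" "f x" 0] by auto
qed

lemma zero_derivative_imp_zero:
  fixes f f' :: "real \<Rightarrow> real"
  assumes "\<And>x. (f has_real_derivative f' x) (at x)" "\<And>x. f' x = 0" "f y = 0"
  shows "f x = 0"
proof -
  have "f x = f y"
    using DERIV_isconst_all[of f x y] assms by metis
  then show ?thesis using assms by simp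
qed

text \<open>Substituting x = K/2^j + s/2^j turns the fine wavelet with indices (j, K) into
  \<open>\<psi> s\<close> and the mother wavelet into its magnification around a dyadic point. The
  condition \<open>j \<ge> 1\<close> makes the two index pairs differ for every K, including K =
  0.\<close>

lemma wavelet_orthogonal_dyadic:
  assumes w: "smooth_cs_wavelet \<psi>" and j: "j \<ge> (1::nat)"
  shows "(\<integral>s. \<psi> (of_int K * (1/2)^j + (1/2)^j * s) * \<psi> s \<partial>lborel) = 0"
proof -
  have p: "2 powr real_of_int (int j) = 2^j" by (simp add: powr_realpow)
  have "0 = integral\<^sup>L lborel (\<lambda>x. wav \<psi> (int j) K x * wav \<psi> 0 0 x)"
    using w j unfolding smooth_cs_wavelet_def by auto
  also have "\<dots> = 2 powr (real_of_int (int j) / 2) * (\<integral>x. \<psi> (2^j * x - K) * \<psi> x \<partial>lborel)"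
    unfolding wav_def p by (simp add: mult.assoc)
  also have "(\<integral>x. \<psi> (2^j * x - K) * \<psi> x \<partial>lborel) =
      \<bar>(1/2)^j\<bar> *\<^sub>R (\<integral>s. \<psi> (2^j * (of_int K * (1/2)^j + (1/2)^j * s) - K)
        * \<psi> (of_int K * (1/2)^j + (1/2)^j * s) \<partial>lborel)"
    by (rule lborel_integral_real_affine) simp
  also have "(\<lambda>s. \<psi> (2^j * (of_int K * (1/2)^j + (1/2)^j * s) - K)
        * \<psi> (of_int K * (1/2)^j + (1/2)^j * s)) = (\<lambda>s. \<psi> (of_int K * (1/2)^j + (1/2)^j * s) * \<psi> s)"
    by (simp add: algebra_simps power_divide)
  finally show ?thesis by simp
qed

text \<open>Testing orthogonality of \<psi> against its rescalings by \<open>(1/2)^j\<close> around a dyadic point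
  and expanding \<psi> there to second order isolates each moment times a derivative of \<psi>.\<close>
lemma wavelet_moments_times_derivatives:
  fixes K :: int and n :: nat
  assumes w: "smooth_cs_wavelet \<psi>" and R: "R \<ge> 0" and supp: "\<And>x. \<bar>x\<bar> > R \<Longrightarrow> \<psi> x = 0"
    and d: "\<And>x. (\<psi> has_real_derivative d1 x) (at x)"
      "\<And>x. (d1 has_real_derivative d2 x) (at x)"
      "\<And>x. (d2 has_real_derivative d3 x) (at x)"
    and c3: "continuous_on UNIV d3"
  defines "x0 \<equiv> real_of_int K * (1/2)^n"
  shows "\<psi> x0 * (\<integral>s. \<psi> s \<partial>lborel) = 0" "d1 x0 * (\<integral>s. s * \<psi> s \<partial>lborel) = 0"
    "d2 x0 * (\<integral>s. s^2 * \<psi> s \<partial>lborel) = 0"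
proof -
  have c: "continuous_on UNIV \<psi>" using d(1) by (meson DERIV_isCont continuous_at_imp_continuous_on)
  have "compact (d3 ` {x0 - R..x0 + R})"
    by (rule compact_continuous_image) (auto intro: continuous_on_subset[OF c3])
  then obtain B where B: "\<And>y. \<bar>y - x0\<bar> \<le> R \<Longrightarrow> \<bar>d3 y\<bar> \<le> B"
    by (fastforce dest!: compact_imp_bounded simp: bounded_iff abs_le_iff)
  have B0: "B \<ge> 0" using B[of x0] R by auto
  define M0 M1 M2 N where "M0 = (\<integral>s. \<psi> s \<partial>lborel)" and "M1 = (\<integral>s. s * \<psi> s \<partial>lborel)"
    and "M2 = (\<integral>s. s^2 * \<psi> s \<partial>lborel)" and "N = (\<integral>s. \<bar>\<psi> s\<bar> \<partial>lborel)"
  \<comment> \<open>Replacing \<open>\<psi> (x0 + \<epsilon> * s)\<close> by its second-order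
    expansion in an integral that is zero leaves a polynomial in \<open>\<epsilon>\<close> of size
    \<epsilon>^3. The condition \<open>\<epsilon> \<le> 1\<close> keeps the argument within distance
    \<open>R\<close> of \<open>x0\<close>, where \<open>B\<close> bounds the third
    derivative.\<close>
  have key: "\<bar>\<psi> x0 * M0 + \<epsilon> * (d1 x0 * M1) + \<epsilon>^2 * (d2 x0 / 2 * M2)\<bar> \<le> B * R^3 * N * \<epsilon>^3"
    if e: "0 < \<epsilon>" "\<epsilon> \<le> 1" and orth: "(\<integral>s. \<psi> (x0 + \<epsilon> * s) * \<psi> s \<partial>lborel) = 0" for \<epsilon>
  proof -
    let ?g = "\<lambda>s. \<psi> (x0 + \<epsilon> * s)"
    let ?p = "\<lambda>s. \<psi> x0 + (\<epsilon> * d1 x0) * s + (\<epsilon>^2 * d2 x0 / 2) * s^2"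
    have cg: "continuous_on UNIV ?g"
      by (intro continuous_on_compose2[OF c] continuous_intros) auto
    have rem: "\<bar>?g s - ?p s\<bar> \<le> B * R^3 * \<epsilon>^3" if s: "\<bar>s\<bar> \<le> R" for s
    proof -
      have "\<bar>?g s - (?g 0 + (\<epsilon> * d1 (x0 + \<epsilon> * 0)) * s + (\<epsilon>^2 * d2 (x0 + \<epsilon> * 0)) / 2 * s^2)\<bar> \<le> (B * \<epsilon>^3) * \<bar>s\<bar>^3"
      proof (rule Maclaurin3_bound[where R=R and g = ?g and ?g1.0 = "\<lambda>s. \<epsilon> * d1 (x0 + \<epsilon> * s)"
              and ?g2.0 = "\<lambda>s. \<epsilon>^2 * d2 (x0 + \<epsilon> * s)" and ?g3.0 = "\<lambda>s. \<epsilon>^3 * d3 (x0 + \<epsilon> * s)"])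
        fix t :: real
        note [derivative_intros] = DERIV_chain2[OF d(1)] DERIV_chain2[OF d(2)] DERIV_chain2[OF d(3)]
        show "(?g has_real_derivative \<epsilon> * d1 (x0 + \<epsilon> * t)) (at t)"
          by (auto intro!: derivative_eq_intros)
        show "((\<lambda>s. \<epsilon> * d1 (x0 + \<epsilon> * s)) has_real_derivative \<epsilon>^2 * d2 (x0 + \<epsilon> * t)) (at t)"
          by (auto intro!: derivative_eq_intros simp: power2_eq_square)
        show "((\<lambda>s. \<epsilon>^2 * d2 (x0 + \<epsilon> * s)) has_real_derivative \<epsilon>^3 * d3 (x0 + \<epsilon> * t)) (at t)"
          by (auto intro!: derivative_eq_intros simp: power2_eq_square power3_eq_cube)
        assume t: "\<bar>t\<bar> \<le> R"
        have "\<bar>\<epsilon> * t\<bar> \<le> 1 * R" unfolding abs_mult by (rule mult_mono) (use e t in auto)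
        then have "\<bar>d3 (x0 + \<epsilon> * t)\<bar> \<le> B" by (intro B) auto
        then show "\<bar>\<epsilon>^3 * d3 (x0 + \<epsilon> * t)\<bar> \<le> B * \<epsilon>^3"
          using e by (simp add: abs_mult mult.commute)
      qed (use s in auto)
      also have "\<dots> \<le> (B * \<epsilon>^3) * R^3"
        by (intro mult_left_mono power_mono) (use s e B0 in auto)
      finally show ?thesis by (simp add: algebra_simps)
    qed
    have "\<bar>\<integral>s. (?g s - ?p s) * \<psi> s \<partial>lborel\<bar> \<le> (B * R^3 * \<epsilon>^3) * N"
      unfolding N_def
      by (rule integral_mult_le_compact_support[OF _ c supp rem])
         (auto intro!: continuous_intros cg)
    moreover have "(\<integral>s. (?g s - ?p s) * \<psi> s \<partial>lborel) =
        (\<integral>s. ?g s * \<psi> s \<partial>lborel) - (\<psi> x0 * M0 + (\<epsilon> * d1 x0) * M1 + (\<epsilon>^2 * d2 x0 / 2) * M2)"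
    proof -
      have i: "integrable lborel (\<lambda>s. ?g s * \<psi> s)" "integrable lborel (\<lambda>s. \<psi> s)"
        "integrable lborel (\<lambda>s. s * \<psi> s)" "integrable lborel (\<lambda>s. s^2 * \<psi> s)"
        using integrable_mult_compact_support[OF cg c supp]
          integrable_mult_compact_support[OF continuous_on_const[of UNIV 1] c supp]
          integrable_mult_compact_support[OF continuous_on_id c supp]
          integrable_mult_compact_support[OF continuous_on_power[OF continuous_on_id, of UNIV 2] c supp]
        by auto
      have "(\<lambda>s. (?g s - ?p s) * \<psi> s) = (\<lambda>s. ?g s * \<psi> s - (\<psi> x0 * \<psi> s +
         (\<epsilon> * d1 x0) * (s * \<psi> s) + (\<epsilon>^2 * d2 x0 / 2) * (s^2 * \<psi> s)))"
        by (simp add: algebra_simps)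
      then show ?thesis
        using i by (simp add: M0_def M1_def M2_def)
    qed
    ultimately show ?thesis using orth by (simp add: algebra_simps abs_minus_commute)
  qed
  \<comment> \<open>The values of \<open>\<epsilon>\<close> used are (1/2)^(n+1+m):
    \<open>x0\<close> is then the integer K 2^(m+1) times \<open>\<epsilon>\<close>, so
    orthogonality is available, and the extra 1 keeps the scale positive even for n = m = 0. The
    fixed factor \<open>q\<close> goes into the coefficients, so that only powers of (1/2)^m
    remain.\<close>
  define q where "q = (1/2::real)^(n+1)"
  have q: "q > 0" "q \<le> 1" using power_le_one[of "1/2::real" "n+1"] by (auto simp: q_def)
  have "\<bar>\<psi> x0 * M0 + (q * (d1 x0 * M1)) * (1/2)^m + (q^2 * (d2 x0 / 2 * M2)) * ((1/2)^m)^2\<bar>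
      \<le> (B * R^3 * N * q^3) * ((1/2)^m)^3" for m
  proof -
    have e1: "of_int (K * 2^(m+1)) * (1/2)^(n+1+m) = x0"
      by (simp add: x0_def power_add field_simps power_divide)
    have e2: "(1/2)^(n+1+m) = (1/2)^m * q" by (simp add: q_def power_add)
    have "(\<integral>s. \<psi> (of_int (K * 2^(m+1)) * (1/2)^(n+1+m) + (1/2)^(n+1+m) * s) * \<psi> s \<partial>lborel) = 0"
      by (rule wavelet_orthogonal_dyadic[OF w]) simp
    then have "(\<integral>s. \<psi> (x0 + ((1/2)^m * q) * s) * \<psi> s \<partial>lborel) = 0" by (simp only: e1, simp only: e2)
    moreover have "(1/2)^m * q \<le> 1"
      using mult_mono[of "(1/2)^m" 1 q 1] q by (auto simp: power_le_one)
    ultimately show ?thesis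
      using key[of "(1/2)^m * q"] q by (simp add: power_mult_distrib algebra_simps)
  qed
  note z = quadratic_coeffs_zero_of_cubic_bound[OF this]
  show "\<psi> x0 * (\<integral>s. \<psi> s \<partial>lborel) = 0" "d1 x0 * (\<integral>s. s * \<psi> s \<partial>lborel) = 0"
    "d2 x0 * (\<integral>s. s^2 * \<psi> s \<partial>lborel) = 0"
    using z q by (auto simp: M0_def M1_def M2_def)
qed

text \<open>A nonzero moment of order i would make the i-th derivative of \<open>\<psi>\<close>
  vanish at all dyadic points, hence everywhere by continuity; compact support integrates this back
  to \<psi> = 0, against the unit norm. The Lipschitz constant is recorded because the power kernels
  are too rough at 0 to carry increments themselves.\<close>

lemma wavelet_vanishing_moments:
  assumes w: "smooth_cs_wavelet \<psi>"
  obtains R L where "R > 0" "\<And>x. \<bar>x\<bar> > R \<Longrightarrow> \<psi> x = 0" "continuous_on UNIV \<psi>"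
    "\<And>x y. \<bar>\<psi> x - \<psi> y\<bar> \<le> L * \<bar>x - y\<bar>"
    "(\<integral>s. \<psi> s \<partial>lborel) = 0" "(\<integral>s. s * \<psi> s \<partial>lborel) = 0" "(\<integral>s. s^2 * \<psi> s \<partial>lborel) = 0"
proof -
  from w obtain d1 d2 d3 where
    d: "\<And>x. (\<psi> has_real_derivative d1 x) (at x)"
      "\<And>x. (d1 has_real_derivative d2 x) (at x)"
      "\<And>x. (d2 has_real_derivative d3 x) (at x)"
    and c3: "continuous_on UNIV d3"
    unfolding smooth_cs_wavelet_def C3_fun_def by blast
  have c: "continuous_on UNIV \<psi>" "continuous_on UNIV d1" "continuous_on UNIV d2"
    using d by (meson DERIV_isCont continuous_at_imp_continuous_on)+
  from w obtain R where R: "R > 0" "\<forall>x\<in>{x. \<psi> x \<noteq> 0}. norm x \<le> R"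
    unfolding smooth_cs_wavelet_def bounded_pos by blast
  have supp: "\<psi> x = 0" if "\<bar>x\<bar> > R" for x using R that by force
  obtain z where z: "\<psi> z \<noteq> 0"
  proof -
    have "integral\<^sup>L lborel (\<lambda>x. wav \<psi> 0 0 x * wav \<psi> 0 0 x) = 1"
      using w unfolding smooth_cs_wavelet_def by auto
    then show thesis using that by (cases "\<forall>z. \<psi> z = 0") (auto simp: wav_def)
  qed
  note M = wavelet_moments_times_derivatives[OF w _ supp d c3]
  have m0: "(\<integral>s. \<psi> s \<partial>lborel) = 0"
  proof (rule ccontr)
    assume "(\<integral>s. \<psi> s \<partial>lborel) \<noteq> 0"
    then have "\<psi> (of_int K * (1/2)^n) = 0" for K n using M(1)[where R=R and K=K and n=n] supp R by auto
    then show False using continuous_dyadic_zero[OF c(1)] z by blast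
  qed
  have d1z: False if "\<And>x. d1 x = 0"
    using zero_derivative_imp_zero[OF d(1) that supp[of "R+1"], of z] z R by auto
  have m1: "(\<integral>s. s * \<psi> s \<partial>lborel) = 0"
  proof (rule ccontr)
    assume "(\<integral>s. s * \<psi> s \<partial>lborel) \<noteq> 0"
    then have "d1 (of_int K * (1/2)^n) = 0" for K n using M(2)[where R=R and K=K and n=n] supp R by auto
    then show False using continuous_dyadic_zero[OF c(2)] d1z by blast
  qed
  \<comment> \<open>This supplies the boundary value that takes d2 = 0 down to d1 = 0, and it turns
    the bound on \<open>d1\<close> over [-R, R] into a global Lipschitz constant.\<close>
  have d1s: "d1 x = 0" if "\<bar>x\<bar> > R" for x
  proof -
    have o: "open {x::real. \<bar>x\<bar> > R}" by (intro open_Collect_less continuous_intros)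
    have "((\<lambda>_. 0) has_real_derivative d1 x) (at x)"
      using has_field_derivative_transform_within_open[OF d(1)[of x] o] that supp by simp
    then show ?thesis using DERIV_unique DERIV_const by blast
  qed
  have m2: "(\<integral>s. s^2 * \<psi> s \<partial>lborel) = 0"
  proof (rule ccontr)
    assume "(\<integral>s. s^2 * \<psi> s \<partial>lborel) \<noteq> 0"
    then have "d2 (of_int K * (1/2)^n) = 0" for K n using M(3)[where R=R and K=K and n=n] supp R by auto
    then have "\<And>x. d2 x = 0" using continuous_dyadic_zero[OF c(3)] by blast
    then have "\<And>x. d1 x = 0" using zero_derivative_imp_zero[OF d(2) _ d1s[of "R+1"]] R by simp
    then show False using d1z by blast
  qed
  have "compact (d1 ` {-R..R})"
    by (rule compact_continuous_image) (auto intro: continuous_on_subset[OF c(2)])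
  then obtain L where L: "\<And>y. \<bar>y\<bar> \<le> R \<Longrightarrow> \<bar>d1 y\<bar> \<le> L"
    by (fastforce dest!: compact_imp_bounded simp: bounded_iff abs_le_iff)
  have "\<bar>d1 y\<bar> \<le> L" for y
    using L[of y] L[of 0] d1s[of y] R by (cases "\<bar>y\<bar> \<le> R") auto
  then have lip: "\<bar>\<psi> x - \<psi> y\<bar> \<le> L * \<bar>x - y\<bar>" for x y
    using field_differentiable_bound[of UNIV \<psi> d1 L x y] d(1) by auto
  show thesis using that[of R L] R supp c(1) lip m0 m1 m2 by blast
qed

section \<open>Kernels smoothed by the wavelet\<close>

text \<open>The exponent 2 has to exceed 1 + \<rho>, where |k|^\<rho> with 1/\<alpha> < \<rho> < 1
  is the growth allowed for the coefficients; the remaining decay is then summable over k.\<close>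

definition qdecay :: "real \<Rightarrow> real" where
  "qdecay x = 1 / (1 + \<bar>x\<bar>)^2"

lemma qdecay_pos: "qdecay x > 0"
  by (auto simp: qdecay_def intro!: divide_pos_pos zero_less_power)

lemma qdecay_ge: "\<bar>x\<bar> \<le> D \<Longrightarrow> 1 / (1 + D)^2 \<le> qdecay x"
  unfolding qdecay_def by (intro divide_left_mono power_mono mult_pos_pos zero_less_power) auto

lemma DERIV_reflect_at:
  fixes f :: "real \<Rightarrow> real"
  assumes "(f has_real_derivative D) (at (x - t))"
  shows "((\<lambda>s. f (x - s)) has_real_derivative - D) (at t)"
proof -
  have "((-) x has_real_derivative -1) (at t)" by (auto intro!: derivative_eq_intros)
  from DERIV_chain2[where g = "(-) x", OF assms this] show ?thesis by simp
qed

text \<open>One notion covers both a truncated power and the difference of two such powers;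
  \<open>A\<close> carries the size, which in the second case is proportional to the distance of the
  exponents. No smoothness is asked below 1, since the powers have a singular derivative at 0. The
  bound on \<open>f4\<close> serves increments of the smoothed kernel.\<close>

definition regular_kernel :: "real \<Rightarrow> real \<Rightarrow> (real \<Rightarrow> real) \<Rightarrow> bool" where
  "regular_kernel M A f \<longleftrightarrow> continuous_on UNIV f \<and> (\<forall>y\<le>0. f y = 0) \<and> (\<forall>y\<le>M. \<bar>f y\<bar> \<le> A) \<and>
     (\<exists>f1 f2 f3 f4. \<forall>y\<ge>1. (f has_real_derivative f1 y) (at y) \<and> (f1 has_real_derivative f2 y) (at y) \<and>
        (f2 has_real_derivative f3 y) (at y) \<and> (f3 has_real_derivative f4 y) (at y) \<and>
        \<bar>f3 y\<bar> \<le> A / y^2 \<and> \<bar>f4 y\<bar> \<le> A / y^2)"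

text \<open>Subtracting from \<open>g\<close> its second-order expansion at 0 does not change the
  integral, because the moments vanish; only the cubic remainder is left.\<close>

lemma vanishing_moments_bound:
  fixes g \<psi> :: "real \<Rightarrow> real"
  assumes c: "continuous_on UNIV \<psi>" and supp: "\<And>x. \<bar>x\<bar> > R \<Longrightarrow> \<psi> x = 0"
    and m: "(\<integral>s. \<psi> s \<partial>lborel) = 0" "(\<integral>s. s * \<psi> s \<partial>lborel) = 0" "(\<integral>s. s^2 * \<psi> s \<partial>lborel) = 0"
    and cg: "continuous_on UNIV g"
    and d: "\<And>t. \<bar>t\<bar> \<le> R \<Longrightarrow> (g has_real_derivative g1 t) (at t)"
    "\<And>t. \<bar>t\<bar> \<le> R \<Longrightarrow> (g1 has_real_derivative g2 t) (at t)"
    "\<And>t. \<bar>t\<bar> \<le> R \<Longrightarrow> (g2 has_real_derivative g3 t) (at t)"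
    and B: "\<And>t. \<bar>t\<bar> \<le> R \<Longrightarrow> \<bar>g3 t\<bar> \<le> B" and B0: "B \<ge> 0"
  shows "\<bar>\<integral>s. g s * \<psi> s \<partial>lborel\<bar> \<le> B * R^3 * (\<integral>s. \<bar>\<psi> s\<bar> \<partial>lborel)"
proof -
  let ?p = "\<lambda>s. g 0 + g1 0 * s + g2 0 / 2 * s^2"
  have i: "integrable lborel (\<lambda>s. g s * \<psi> s)" "integrable lborel (\<lambda>s. \<psi> s)"
    "integrable lborel (\<lambda>s. s * \<psi> s)" "integrable lborel (\<lambda>s. s^2 * \<psi> s)"
    using integrable_mult_compact_support[OF cg c supp]
      integrable_mult_compact_support[OF continuous_on_const[of UNIV 1] c supp]
      integrable_mult_compact_support[OF continuous_on_id c supp]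
      integrable_mult_compact_support[OF continuous_on_power[OF continuous_on_id, of UNIV 2] c supp]
    by auto
  have "(\<lambda>s. (g s - ?p s) * \<psi> s) =
      (\<lambda>s. g s * \<psi> s - (g 0 * \<psi> s + g1 0 * (s * \<psi> s) + (g2 0 / 2) * (s^2 * \<psi> s)))"
    by (simp add: algebra_simps)
  then have "(\<integral>s. (g s - ?p s) * \<psi> s \<partial>lborel) = (\<integral>s. g s * \<psi> s \<partial>lborel)"
    using i m by simp
  moreover have "\<bar>\<integral>s. (g s - ?p s) * \<psi> s \<partial>lborel\<bar> \<le> (B * R^3) * (\<integral>s. \<bar>\<psi> s\<bar> \<partial>lborel)"
  proof (rule integral_mult_le_compact_support[OF _ c supp])
    show "continuous_on UNIV (\<lambda>s. g s - ?p s)" by (intro continuous_intros cg)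
    fix s assume s: "\<bar>s\<bar> \<le> R"
    have "\<bar>g s - ?p s\<bar> \<le> B * \<bar>s\<bar>^3" by (rule Maclaurin3_bound[OF d B s])
    also have "\<dots> \<le> B * R^3" by (intro mult_left_mono power_mono) (use s B0 in auto)
    finally show "\<bar>g s - ?p s\<bar> \<le> B * R^3" .
  qed
  ultimately show ?thesis by simp
qed

context
  fixes \<psi> :: "real \<Rightarrow> real" and R L :: real
  assumes R: "R > 0" and supp: "\<And>x. \<bar>x\<bar> > R \<Longrightarrow> \<psi> x = 0" and c: "continuous_on UNIV \<psi>"
    and lip: "\<And>x y. \<bar>\<psi> x - \<psi> y\<bar> \<le> L * \<bar>x - y\<bar>"
    and m: "(\<integral>s. \<psi> s \<partial>lborel) = 0" "(\<integral>s. s * \<psi> s \<partial>lborel) = 0" "(\<integral>s. s^2 * \<psi> s \<partial>lborel) = 0"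
begin

context
  fixes f f1 f2 f3 f4 :: "real \<Rightarrow> real" and A :: real
  assumes cf: "continuous_on UNIV f" and f0: "\<And>y. y \<le> 0 \<Longrightarrow> f y = 0"
    and fA: "\<And>y. y \<le> 3 * R + 3 \<Longrightarrow> \<bar>f y\<bar> \<le> A"
    and d: "\<And>y. y \<ge> 1 \<Longrightarrow> (f has_real_derivative f1 y) (at y)"
      "\<And>y. y \<ge> 1 \<Longrightarrow> (f1 has_real_derivative f2 y) (at y)"
      "\<And>y. y \<ge> 1 \<Longrightarrow> (f2 has_real_derivative f3 y) (at y)"
      "\<And>y. y \<ge> 1 \<Longrightarrow> (f3 has_real_derivative f4 y) (at y)"
    and f3: "\<And>y. y \<ge> 1 \<Longrightarrow> \<bar>f3 y\<bar> \<le> A / y^2"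
    and f4: "\<And>y. y \<ge> 1 \<Longrightarrow> \<bar>f4 y\<bar> \<le> A / y^2"
begin

text \<open>When |s| \<le> R, every argument x - s is at least x - R, which here is at least (1 +
  x)/2. So the derivative bounds are available and comparing inverse squares costs a factor
  4.\<close>

lemma conv_far_bound_aux:
  assumes "x \<ge> 2 * R + 2" "z \<ge> x - R"
  shows "z \<ge> 1" "A / z^2 \<le> 4 * A * qdecay x"
proof -
  show z: "z \<ge> 1" using assms R by linarith
  have A0: "A \<ge> 0" using fA[of 0] R by auto
  have "((1 + x)/2)^2 \<le> z^2" by (intro power_mono) (use assms R in auto)
  then have "A / z^2 \<le> A / ((1 + x)/2)^2"
    by (intro divide_left_mono A0 mult_pos_pos zero_less_power) (use z assms R in auto)
  also have "\<dots> = 4 * A * qdecay x" using assms R by (simp add: qdecay_def power_divide)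
  finally show "A / z^2 \<le> 4 * A * qdecay x" .
qed

lemma continuous_shift: "continuous_on UNIV (\<lambda>s. f (x - s))"
  by (intro continuous_on_compose2[OF cf] continuous_intros) auto

lemma conv_zero:
  assumes "x \<le> -R" shows "(\<integral>s. f (x - s) * \<psi> s \<partial>lborel) = 0"
proof -
  have "(\<lambda>s. f (x - s) * \<psi> s) = (\<lambda>_. 0)"
  proof
    fix s show "f (x - s) * \<psi> s = 0"
      using f0[of "x - s"] supp[of s] assms by (cases "\<bar>s\<bar> > R") auto
  qed
  then show ?thesis by simp
qed

text \<open>There are three zones. Left of -R the kernel and the support of \<open>\<psi>\<close> do
  not meet. Up to 2R + 2 the kernel is at most \<open>A\<close> and \<open>qdecay\<close> is at
  least 1/(2R + 3)^2. Beyond, the vanishing moments replace the kernel by its third derivative, at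
  the cost 4 R^3.\<close>

lemma conv_bound:
  "\<bar>\<integral>s. f (x - s) * \<psi> s \<partial>lborel\<bar>
    \<le> ((2 * R + 3)^2 + 4 * R^3) * (\<integral>s. \<bar>\<psi> s\<bar> \<partial>lborel) * A * qdecay x"
proof -
  define N where "N = (\<integral>s. \<bar>\<psi> s\<bar> \<partial>lborel)"
  have N0: "N \<ge> 0" by (simp add: N_def)
  have A0: "A \<ge> 0" using fA[of 0] R by auto
  note nn = N0 A0 R less_imp_le[OF R] less_imp_le[OF qdecay_pos]
  consider "x \<le> -R" | "-R < x" "x < 2 * R + 2" | "x \<ge> 2 * R + 2" by linarith
  then show ?thesis
  proof cases
    case 1
    show ?thesis unfolding conv_zero[OF 1] N_def[symmetric]
      using nn by auto
  next
    case 2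
    have "\<bar>\<integral>s. f (x - s) * \<psi> s \<partial>lborel\<bar> \<le> A * N"
      unfolding N_def
      by (rule integral_mult_le_compact_support[OF continuous_shift c supp]) (use 2 in \<open>auto intro!: fA\<close>)
    also have "\<dots> = ((2 * R + 3)^2 * N * A) * (1 / (1 + (2 * R + 2))^2)"
      using R by (simp add: add.commute)
    also have "\<dots> \<le> ((2 * R + 3)^2 * N * A) * qdecay x"
      by (intro mult_left_mono qdecay_ge) (use 2 nn in auto)
    also have "\<dots> \<le> ((2 * R + 3)^2 + 4 * R^3) * N * A * qdecay x"
      by (intro mult_right_mono) (use nn in auto)
    finally show ?thesis unfolding N_def .
  next
    case 3
    have "\<bar>\<integral>s. f (x - s) * \<psi> s \<partial>lborel\<bar> \<le> (4 * A * qdecay x) * R^3 * N"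
      unfolding N_def
    proof (rule vanishing_moments_bound[OF c supp m continuous_shift, where ?g1.0="\<lambda>s. - f1 (x - s)"
          and ?g2.0="\<lambda>s. f2 (x - s)" and ?g3.0="\<lambda>s. - f3 (x - s)"])
      fix t assume t: "\<bar>t\<bar> \<le> R"
      then have z: "x - t \<ge> x - R" by simp
      note far = conv_far_bound_aux[OF 3 z]
      note [derivative_intros] = DERIV_reflect_at[OF d(1)[OF far(1)]]
         DERIV_reflect_at[OF d(2)[OF far(1)]] DERIV_reflect_at[OF d(3)[OF far(1)]]
      show "((\<lambda>s. f (x - s)) has_real_derivative - f1 (x - t)) (at t)"
        "((\<lambda>s. - f1 (x - s)) has_real_derivative f2 (x - t)) (at t)"
        "((\<lambda>s. f2 (x - s)) has_real_derivative - f3 (x - t)) (at t)"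
        by (auto intro!: derivative_eq_intros)
      show "\<bar>- f3 (x - t)\<bar> \<le> 4 * A * qdecay x"
        using f3[OF far(1)] far(2) by simp
    qed (use nn in auto)
    also have "\<dots> = (4 * R^3) * N * A * qdecay x" by simp
    also have "\<dots> \<le> ((2 * R + 3)^2 + 4 * R^3) * N * A * qdecay x"
      by (intro mult_right_mono) (use nn in auto)
    finally show ?thesis unfolding N_def .
  qed
qed

text \<open>The kernel need not be Lipschitz near 0, so a substitution moves the increment onto
  \<open>\<psi>\<close>. The integrand then lives on [0, 3R + 3]: to the left \<open>f\<close>
  vanishes, and to the right both translates of \<open>\<psi>\<close> are outside their support
  because y \<le> 2R + 3.\<close>

lemma conv_near_Lipschitz:
  assumes xy: "x \<le> y" "y \<le> 2 * R + 3"
  shows "\<bar>(\<integral>s. f (x - s) * \<psi> s \<partial>lborel) - (\<integral>s. f (y - s) * \<psi> s \<partial>lborel)\<bar>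
    \<le> (3 * R + 3) * L * A * (y - x)"
proof -
  have A0: "A \<ge> 0" using fA[of 0] R by auto
  have L0: "L \<ge> 0" using lip[of 0 1] by auto
  have swap: "(\<integral>s. f (x - s) * \<psi> s \<partial>lborel) = (\<integral>s. f s * \<psi> (x - s) \<partial>lborel)" for x
    using lborel_integral_real_affine[of "-1" "\<lambda>s. f (x - s) * \<psi> s" x] by simp
  have i: "integrable lborel (\<lambda>s. f s * \<psi> (x - s))" for x
    by (rule integrable_mult_compact_support[OF cf, where R = "R + \<bar>x\<bar>"])
      (auto intro!: supp continuous_on_compose2[OF c] continuous_intros)
  have "\<bar>(\<integral>s. f (x - s) * \<psi> s \<partial>lborel) - (\<integral>s. f (y - s) * \<psi> s \<partial>lborel)\<bar>
      = \<bar>\<integral>s. f s * \<psi> (x - s) - f s * \<psi> (y - s) \<partial>lborel\<bar>"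
    unfolding swap using i by simp
  also have "\<dots> \<le> (\<integral>s. \<bar>f s * \<psi> (x - s) - f s * \<psi> (y - s)\<bar> \<partial>lborel)"
    by (rule integral_abs_bound)
  also have "\<dots> \<le> (\<integral>s. (A * (L * (y - x))) * indicator {0..3*R+3} s \<partial>lborel)"
  proof (rule integral_mono)
    show "integrable lborel (\<lambda>s. \<bar>f s * \<psi> (x - s) - f s * \<psi> (y - s)\<bar>)"
      using i[of x] i[of y] by simp
    show "integrable lborel (\<lambda>s. (A * (L * (y - x))) * indicator {0..3*R+3} s :: real)"
      by (intro integrable_mult_right integrable_real_indicator) (use R in \<open>auto simp: emeasure_lborel_Icc_eq\<close>)
    fix s
    have "\<bar>f s * \<psi> (x - s) - f s * \<psi> (y - s)\<bar> = \<bar>f s\<bar> * \<bar>\<psi> (x - s) - \<psi> (y - s)\<bar>"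
      by (simp add: abs_mult[symmetric] right_diff_distrib)
    moreover have "\<bar>f s\<bar> * \<bar>\<psi> (x - s) - \<psi> (y - s)\<bar> \<le> A * (L * (y - x))" if "s \<le> 3*R+3"
      by (intro mult_mono fA that) (use lip[of "x - s" "y - s"] xy A0 in auto)
    moreover have "f s = 0" if "s < 0" using f0 that by simp
    moreover have "\<psi> (x - s) = 0 \<and> \<psi> (y - s) = 0" if "s > 3*R+3"
      using that xy R by (auto intro!: supp)
    ultimately show "\<bar>f s * \<psi> (x - s) - f s * \<psi> (y - s)\<bar> \<le> (A * (L * (y - x))) * indicator {0..3*R+3} s"
      by (cases "s < 0"; cases "s > 3*R+3") (auto simp: indicator_def)
  qed
  also have "\<dots> = (3 * R + 3) * L * A * (y - x)" using R by simp
  finally show ?thesis .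
qed

text \<open>The moment argument is applied to s -> f(x - s) - f(y - s). Its third derivative is an
  increment of \<open>f3\<close>, which the mean value theorem on [x - R, \<infinity>) controls by
  \<open>f4\<close>.\<close>

lemma conv_far_Lipschitz:
  assumes xy: "x \<le> y" "2 * R + 2 \<le> x"
  shows "\<bar>(\<integral>s. f (x - s) * \<psi> s \<partial>lborel) - (\<integral>s. f (y - s) * \<psi> s \<partial>lborel)\<bar>
    \<le> 4 * R^3 * (\<integral>s. \<bar>\<psi> s\<bar> \<partial>lborel) * A * (y - x) * qdecay x"
proof -
  have A0: "A \<ge> 0" using fA[of 0] R by auto
  have "(\<integral>s. f (x - s) * \<psi> s \<partial>lborel) - (\<integral>s. f (y - s) * \<psi> s \<partial>lborel) =
      (\<integral>s. (f (x - s) - f (y - s)) * \<psi> s \<partial>lborel)"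
    using integrable_mult_compact_support[OF continuous_shift c supp]
    by (simp add: left_diff_distrib)
  moreover have "\<bar>\<integral>s. (f (x - s) - f (y - s)) * \<psi> s \<partial>lborel\<bar>
     \<le> (4 * A * qdecay x * (y - x)) * R^3 * (\<integral>s. \<bar>\<psi> s\<bar> \<partial>lborel)"
  proof (rule vanishing_moments_bound[OF c supp m, where ?g1.0="\<lambda>s. - (f1 (x - s) - f1 (y - s))"
        and ?g2.0="\<lambda>s. f2 (x - s) - f2 (y - s)" and ?g3.0="\<lambda>s. - (f3 (x - s) - f3 (y - s))"])
    fix t assume t: "\<bar>t\<bar> \<le> R"
    then have z: "x - t \<ge> x - R" "y - t \<ge> x - R" using xy by auto
    note far = conv_far_bound_aux[OF xy(2) z(1)] conv_far_bound_aux[OF xy(2) z(2)]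
    note [derivative_intros] = DERIV_reflect_at[OF d(1)[OF far(1)]]
      DERIV_reflect_at[OF d(2)[OF far(1)]] DERIV_reflect_at[OF d(3)[OF far(1)]]
      DERIV_reflect_at[OF d(1)[OF far(3)]]
      DERIV_reflect_at[OF d(2)[OF far(3)]] DERIV_reflect_at[OF d(3)[OF far(3)]]
    show "((\<lambda>s. f (x - s) - f (y - s)) has_real_derivative - (f1 (x - t) - f1 (y - t))) (at t)"
      "((\<lambda>s. - (f1 (x - s) - f1 (y - s))) has_real_derivative f2 (x - t) - f2 (y - t)) (at t)"
      "((\<lambda>s. f2 (x - s) - f2 (y - s)) has_real_derivative - (f3 (x - t) - f3 (y - t))) (at t)"
      by (auto intro!: derivative_eq_intros)
    have "norm (f3 (x - t) - f3 (y - t)) \<le> (4 * A * qdecay x) * norm ((x - t) - (y - t))"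
    proof (rule field_differentiable_bound[where S = "{x - R..}" and f' = f4])
      fix z assume "z \<in> {x - R..}"
      then have "z \<ge> x - R" by simp
      note far = conv_far_bound_aux[OF xy(2) this]
      show "(f3 has_field_derivative f4 z) (at z within {x - R..})"
        using d(4)[OF far(1)] by (rule has_field_derivative_at_within)
      show "norm (f4 z) \<le> 4 * A * qdecay x" using f4[OF far(1)] far(2) by simp
    qed (use z in auto)
    then show "\<bar>- (f3 (x - t) - f3 (y - t))\<bar> \<le> 4 * A * qdecay x * (y - x)"
      using xy by (simp add: abs_minus_commute)
  next
    show "continuous_on UNIV (\<lambda>s. f (x - s) - f (y - s))"
      by (intro continuous_intros continuous_shift)
    show "0 \<le> 4 * A * qdecay x * (y - x)" using A0 xy less_imp_le[OF qdecay_pos] by auto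
  qed
  ultimately show ?thesis by (simp only: mult.commute mult.left_commute)
qed

end

text \<open>The constant is chosen before \<open>f\<close> and \<open>A\<close>, which later makes
  the bounds on \<open>Psi\<close> uniform in the exponent v.\<close>

lemma conv_difference_bound:
  "\<exists>C>0. \<forall>f A x y. regular_kernel (3 * R + 3) A f \<longrightarrow>
     \<bar>(\<integral>s. f (x - s) * \<psi> s \<partial>lborel) - (\<integral>s. f (y - s) * \<psi> s \<partial>lborel)\<bar>
       \<le> C * A * min 1 \<bar>x - y\<bar> * (qdecay x + qdecay y)"
proof -
  define N where "N = (\<integral>s. \<bar>\<psi> s\<bar> \<partial>lborel)"
  define C1 where "C1 = ((2 * R + 3)^2 + 4 * R^3) * N"
  define C2 where "C2 = (3 * R + 3) * L * (2 * R + 4)^2"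
  define C3 where "C3 = 4 * R^3 * N"
  define C where "C = C1 + C2 + C3 + 1"
  have L0: "L \<ge> 0" using lip[of 0 1] by auto
  have N0: "N \<ge> 0" by (simp add: N_def)
  have C0: "C1 \<ge> 0" "C2 \<ge> 0" "C3 \<ge> 0" using R L0 N0 by (auto simp: C1_def C2_def C3_def)
  have Cp: "C > 0" using C0 by (auto simp: C_def)
  show ?thesis
  proof (intro exI conjI allI impI)
    show "C > 0" by fact
  next
    fix f :: "real \<Rightarrow> real" and A x y :: real
    assume "regular_kernel (3 * R + 3) A f"
    then obtain f1 f2 f3 f4 where cf: "continuous_on UNIV f" and f0: "\<forall>y\<le>0. f y = 0"
      and fA: "\<forall>y\<le>3 * R + 3. \<bar>f y\<bar> \<le> A"
      and d: "\<forall>y\<ge>1. (f has_real_derivative f1 y) (at y) \<and> (f1 has_real_derivative f2 y) (at y) \<and>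
        (f2 has_real_derivative f3 y) (at y) \<and> (f3 has_real_derivative f4 y) (at y) \<and>
        \<bar>f3 y\<bar> \<le> A / y^2 \<and> \<bar>f4 y\<bar> \<le> A / y^2"
      unfolding regular_kernel_def by (elim conjE exE) (rule that)
    define F where "F x = (\<integral>s. f (x - s) * \<psi> s \<partial>lborel)" for x
    have A0: "A \<ge> 0" using fA[rule_format, of 0] R by auto
    have b: "\<bar>F x\<bar> \<le> C1 * A * qdecay x" for x
      unfolding F_def C1_def N_def
      by (rule conv_bound[where ?f1.0=f1 and ?f2.0=f2 and ?f3.0=f3 and ?f4.0=f4])
         (use cf f0 fA d in auto)
    have z: "F x = 0" if "x \<le> -R" for x
      unfolding F_def by (rule conv_zero[where ?f1.0=f1 and ?f2.0=f2 and ?f3.0=f3 and ?f4.0=f4])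
         (use cf f0 fA d that in auto)
    have n: "\<bar>F x - F y\<bar> \<le> (3 * R + 3) * L * A * (y - x)" if "x \<le> y" "y \<le> 2 * R + 3" for x y
      unfolding F_def by (rule conv_near_Lipschitz[where ?f1.0=f1 and ?f2.0=f2 and ?f3.0=f3 and ?f4.0=f4])
         (use cf f0 fA d that in auto)
    have f: "\<bar>F x - F y\<bar> \<le> C3 * A * (y - x) * qdecay x" if "x \<le> y" "2 * R + 2 \<le> x" for x y
      unfolding F_def C3_def N_def
      by (rule conv_far_Lipschitz[where ?f1.0=f1 and ?f2.0=f2 and ?f3.0=f3 and ?f4.0=f4])
         (use cf f0 fA d that in auto)
    note q0 = less_imp_le[OF qdecay_pos]
    \<comment> \<open>With y - x \<le> 1, the case y \<ge> 2R + 3 forces x \<ge> 2R + 2, so the far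
      estimate applies. In the middle case |x| \<le> 2R + 3, so \<open>qdecay x\<close> is at least
      1/(2R + 4)^2, the source of the square in \<open>C2\<close>.\<close>
    have ordered: "\<bar>F x - F y\<bar> \<le> C * A * (y - x) * (qdecay x + qdecay y)"
      if xy: "x \<le> y" "y \<le> x + 1" for x y
    proof -
      consider "y \<le> -R" | "-R < y" "y < 2 * R + 3" | "y \<ge> 2 * R + 3" by linarith
      then show ?thesis
      proof cases
        case 1
        then show ?thesis using z[of x] z[of y] xy A0 Cp q0[of x] q0[of y] by auto
      next
        case 2
        have "\<bar>F x - F y\<bar> \<le> (3 * R + 3) * L * A * (y - x)" using n xy 2 by auto
        also have "\<dots> = (C2 * A * (y - x)) * (1 / (1 + (2 * R + 3))^2)"
          using R by (simp add: C2_def add.commute)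
        also have "\<dots> \<le> (C2 * A * (y - x)) * qdecay x"
          by (intro mult_left_mono qdecay_ge) (use 2 xy R C0 A0 in auto)
        also have "\<dots> \<le> (C * A * (y - x)) * (qdecay x + qdecay y)"
          by (intro mult_mono) (use C0 A0 xy q0 in \<open>auto simp: C_def\<close>)
        finally show ?thesis .
      next
        case 3
        have "\<bar>F x - F y\<bar> \<le> C3 * A * (y - x) * qdecay x" using f xy 3 by auto
        also have "\<dots> \<le> (C * A * (y - x)) * (qdecay x + qdecay y)"
          by (intro mult_mono) (use C0 A0 xy q0 in \<open>auto simp: C_def\<close>)
        finally show ?thesis .
      qed
    qed
    have "\<bar>F x - F y\<bar> \<le> C * A * min 1 \<bar>x - y\<bar> * (qdecay x + qdecay y)"
    proof (cases "\<bar>x - y\<bar> \<le> 1")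
      case True
      then show ?thesis
        using ordered[of x y] ordered[of y x]
        by (cases "x \<le> y") (auto simp: abs_minus_commute add.commute)
    next
      case False
      have "\<bar>F x - F y\<bar> \<le> C1 * A * (qdecay x + qdecay y)"
        using b[of x] b[of y] by (simp add: distrib_left)
      also have "\<dots> \<le> C * A * (qdecay x + qdecay y)"
        by (intro mult_right_mono) (use C0 A0 q0 in \<open>auto simp: C_def\<close>)
      finally show ?thesis using False by simp
    qed
    then show "\<bar>(\<integral>s. f (x - s) * \<psi> s \<partial>lborel) - (\<integral>s. f (y - s) * \<psi> s \<partial>lborel)\<bar>
       \<le> C * A * min 1 \<bar>x - y\<bar> * (qdecay x + qdecay y)" by (simp add: F_def)
  qed
qed

end

section \<open>Power kernels and their dependence on the exponent\<close>

lemma continuous_pospow: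
  assumes "\<kappa> > 0" shows "continuous_on UNIV (\<lambda>y. pospow y \<kappa>)"
proof -
  have "continuous_on UNIV (\<lambda>y::real. max 0 y powr \<kappa>)"
    by (rule continuous_on_powr') (use assms in \<open>auto intro!: continuous_intros\<close>)
  moreover have "(\<lambda>y::real. max 0 y powr \<kappa>) = (\<lambda>y. pospow y \<kappa>)"
    by (auto simp: pospow_def max_def)
  ultimately show ?thesis by (simp only:)
qed

lemma powr_le_max:
  fixes y \<kappa> :: real
  assumes "0 \<le> \<kappa>" "\<kappa> \<le> 1" "y > 0" shows "y powr \<kappa> \<le> max 1 y"
proof (cases "y \<ge> 1")
  case True
  then show ?thesis using powr_mono[of \<kappa> 1 y] assms by auto
next
  case False
  then show ?thesis using powr_mono2[of \<kappa> y 1] assms by auto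
qed

text \<open>This bounds the derivative of y^\<kappa> in \<kappa>. The logarithm is absorbed by
  y^(1-\<kappa>)/(1-\<kappa>) above 1 and by y^(-\<kappa>)/\<kappa> below 1; the margin
  \<open>\<delta>\<close> at both ends bounds the two denominators from below.\<close>

lemma powr_ln_bound:
  fixes y \<kappa> \<delta> :: real
  assumes "0 < \<delta>" "\<delta> \<le> \<kappa>" "\<kappa> \<le> 1 - \<delta>" "y > 0"
  shows "\<bar>y powr \<kappa> * ln y\<bar> \<le> max 1 y / \<delta>"
proof (cases "y \<ge> 1")
  case True
  have "ln y \<le> y powr (1 - \<kappa>) / (1 - \<kappa>)" by (rule ln_powr_bound) (use True assms in auto)
  then have "y powr \<kappa> * ln y \<le> y powr \<kappa> * (y powr (1 - \<kappa>) / (1 - \<kappa>))"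
    by (intro mult_left_mono) auto
  also have "\<dots> = y / (1 - \<kappa>)" using assms by (simp add: powr_add[symmetric])
  also have "\<dots> \<le> y / \<delta>" by (intro divide_left_mono mult_pos_pos) (use assms in auto)
  finally show ?thesis using True by (simp add: abs_mult)
next
  case False
  then have y: "1 / y \<ge> 1" using assms by simp
  have "ln (1/y) \<le> (1/y) powr \<kappa> / \<kappa>" by (rule ln_powr_bound) (use y assms in auto)
  then have "y powr \<kappa> * ln (1/y) \<le> y powr \<kappa> * ((1/y) powr \<kappa> / \<kappa>)"
    by (intro mult_left_mono) auto
  also have "\<dots> = 1 / \<kappa>" using assms by (simp add: powr_mult[symmetric])
  also have "\<dots> \<le> 1 / \<delta>" by (intro divide_left_mono mult_pos_pos) (use assms in auto)
  finally have "y powr \<kappa> * ln (1/y) \<le> 1 / \<delta>" .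
  moreover have "\<bar>y powr \<kappa> * ln y\<bar> = y powr \<kappa> * ln (1/y)"
    using False assms by (simp add: abs_mult ln_div)
  ultimately show ?thesis using False by simp
qed

lemma powr_exponent_Lipschitz:
  fixes y \<kappa> \<kappa>' \<delta> :: real
  assumes "0 < \<delta>" "\<kappa> \<in> {\<delta>..1-\<delta>}" "\<kappa>' \<in> {\<delta>..1-\<delta>}" "y > 0"
  shows "\<bar>y powr \<kappa> - y powr \<kappa>'\<bar> \<le> max 1 y / \<delta> * \<bar>\<kappa> - \<kappa>'\<bar>"
proof -
  have "norm (y powr \<kappa> - y powr \<kappa>') \<le> max 1 y / \<delta> * norm (\<kappa> - \<kappa>')"
  proof (rule field_differentiable_bound[where S = "{\<delta>..1-\<delta>}" and f' = "\<lambda>\<kappa>. y powr \<kappa> * ln y"])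
    fix z assume z: "z \<in> {\<delta>..1-\<delta>}"
    show "((powr) y has_field_derivative y powr z * ln y) (at z within {\<delta>..1-\<delta>})"
    proof -
      have "((\<lambda>z. exp (z * ln y)) has_real_derivative exp (z * ln y) * ln y) (at z)"
        by (auto intro!: derivative_eq_intros)
      moreover have "(powr) y = (\<lambda>z. exp (z * ln y))"
        using assms by (auto simp: powr_def)
      ultimately have "((powr) y has_real_derivative y powr z * ln y) (at z)"
        by simp
      then show ?thesis by (rule has_field_derivative_at_within)
    qed
    show "norm (y powr z * ln y) \<le> max 1 y / \<delta>"
      using powr_ln_bound[of \<delta> z y] z assms by auto
  qed (use assms in auto)
  then show ?thesis by simp
qed

text \<open>The third and fourth derivatives of a difference of two powers have this form.
  Coefficient and exponent both move, so the product is split; each piece grows at most linearly in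
  y, and y times y^(-3) is the source of the inverse square in
  \<open>regular_kernel\<close>.\<close>

lemma powr_coeff_Lipschitz:
  fixes y \<kappa> \<kappa>' \<delta> c c' P :: real
  assumes \<delta>: "0 < \<delta>" and \<kappa>: "\<kappa> \<in> {\<delta>..1-\<delta>}" "\<kappa>' \<in> {\<delta>..1-\<delta>}" and y: "y \<ge> 1"
    and c: "\<bar>c - c'\<bar> \<le> P * \<bar>\<kappa> - \<kappa>'\<bar>" "\<bar>c'\<bar> \<le> P" and n: "n \<ge> (3::real)"
  shows "\<bar>c * y powr (\<kappa> - n) - c' * y powr (\<kappa>' - n)\<bar> \<le> P * (1 + 1/\<delta>) * \<bar>\<kappa> - \<kappa>'\<bar> / y^2"
proof -
  have "c * y powr (\<kappa> - n) - c' * y powr (\<kappa>' - n)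
      = ((c - c') * y powr \<kappa> + c' * (y powr \<kappa> - y powr \<kappa>')) * y powr (-n)"
    using y by (simp add: powr_diff powr_minus field_simps)
  then have "\<bar>c * y powr (\<kappa> - n) - c' * y powr (\<kappa>' - n)\<bar>
      = \<bar>(c - c') * y powr \<kappa> + c' * (y powr \<kappa> - y powr \<kappa>')\<bar> * y powr (-n)"
    by (simp add: abs_mult)
  also have "\<dots> \<le> (P * \<bar>\<kappa> - \<kappa>'\<bar> * y + P * (y / \<delta> * \<bar>\<kappa> - \<kappa>'\<bar>)) * y powr (-3)"
  proof (intro mult_mono)
    have "\<bar>c - c'\<bar> * y powr \<kappa> \<le> (P * \<bar>\<kappa> - \<kappa>'\<bar>) * y"
      by (intro mult_mono c) (use c powr_le_max[of \<kappa> y] \<kappa> \<delta> y in auto)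
    moreover have "\<bar>c'\<bar> * \<bar>y powr \<kappa> - y powr \<kappa>'\<bar> \<le> P * (y / \<delta> * \<bar>\<kappa> - \<kappa>'\<bar>)"
      by (intro mult_mono c) (use c powr_exponent_Lipschitz[of \<delta> \<kappa> \<kappa>' y] \<kappa> \<delta> y in \<open>auto simp: max_def split: if_splits\<close>)
    ultimately show "\<bar>(c - c') * y powr \<kappa> + c' * (y powr \<kappa> - y powr \<kappa>')\<bar> \<le> P * \<bar>\<kappa> - \<kappa>'\<bar> * y + P * (y / \<delta> * \<bar>\<kappa> - \<kappa>'\<bar>)"
      using abs_triangle_ineq[of "(c - c') * y powr \<kappa>" "c' * (y powr \<kappa> - y powr \<kappa>')"]
      by (simp add: abs_mult)
    show "y powr (-n) \<le> y powr (-3)" using n y by (intro powr_mono) auto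
  qed (use c \<delta> y in auto)
  also have "y powr (-3) = 1 / y^3" using y by (simp add: powr_minus powr_numeral field_simps)
  also have "(P * \<bar>\<kappa> - \<kappa>'\<bar> * y + P * (y / \<delta> * \<bar>\<kappa> - \<kappa>'\<bar>)) * (1 / y^3) = P * (1 + 1/\<delta>) * \<bar>\<kappa> - \<kappa>'\<bar> / y^2"
    using y \<delta> by (simp add: field_simps power2_eq_square power3_eq_cube)
  finally show ?thesis .
qed

lemma pospow_derivative:
  assumes "y \<ge> 1" shows "((\<lambda>y. pospow y \<kappa>) has_real_derivative \<kappa> * y powr (\<kappa> - 1)) (at y)"
proof -
  have "((\<lambda>y. y powr \<kappa>) has_real_derivative \<kappa> * y powr (\<kappa> - 1)) (at y)"
    using assms by (intro has_real_derivative_powr) auto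
  then show ?thesis
    by (rule has_field_derivative_transform_within_open[where S = "{0<..}"]) (use assms in \<open>auto simp: pospow_def\<close>)
qed

lemma powr_mult_derivative:
  fixes c y \<kappa> n :: real
  assumes "y \<ge> 1"
  shows "((\<lambda>y. c * y powr (\<kappa> - n)) has_real_derivative c * (\<kappa> - n) * y powr (\<kappa> - (n + 1))) (at y)"
proof -
  have "((\<lambda>y. y powr (\<kappa> - n)) has_real_derivative (\<kappa> - n) * y powr (\<kappa> - n - 1)) (at y)"
    using assms by (intro has_real_derivative_powr) auto
  from DERIV_cmult[OF this, of c] show ?thesis by (simp add: algebra_simps)
qed

text \<open>\<open>Psi\<close> is the truncated power smoothed by \<open>\<psi>\<close>, and its
  increment in v is the smoothed difference of two powers. Both kernels are regular, with
  \<open>A\<close> constant in the first case and proportional to |v - v'| in the second, so one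
  convolution estimate yields both claims.\<close>

lemma Psi_increment_bounds:
  assumes w: "smooth_cs_wavelet \<psi>" and \<delta>: "\<delta> > 0"
  obtains C where "C > 0"
    "\<And>v x y. v - 1/\<alpha> \<in> {\<delta>..1-\<delta>} \<Longrightarrow>
       \<bar>Psi \<psi> \<alpha> x v - Psi \<psi> \<alpha> y v\<bar> \<le> C * min 1 \<bar>x - y\<bar> * (qdecay x + qdecay y)"
    "\<And>v v' x y. v - 1/\<alpha> \<in> {\<delta>..1-\<delta>} \<Longrightarrow> v' - 1/\<alpha> \<in> {\<delta>..1-\<delta>} \<Longrightarrow>
       \<bar>(Psi \<psi> \<alpha> x v - Psi \<psi> \<alpha> x v') - (Psi \<psi> \<alpha> y v - Psi \<psi> \<alpha> y v')\<bar>
         \<le> C * \<bar>v - v'\<bar> * min 1 \<bar>x - y\<bar> * (qdecay x + qdecay y)"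
proof -
  obtain R L where R: "R > 0" and supp: "\<And>x. \<bar>x\<bar> > R \<Longrightarrow> \<psi> x = 0" and c: "continuous_on UNIV \<psi>"
    and lip: "\<And>x y. \<bar>\<psi> x - \<psi> y\<bar> \<le> L * \<bar>x - y\<bar>"
    and m: "(\<integral>s. \<psi> s \<partial>lborel) = 0" "(\<integral>s. s * \<psi> s \<partial>lborel) = 0" "(\<integral>s. s^2 * \<psi> s \<partial>lborel) = 0"
    by (rule wavelet_vanishing_moments[OF w]) (rule that)
  from conv_difference_bound[OF R supp c lip m] obtain C where C0: "C > 0" and
    C: "\<And>f A x y. regular_kernel (3 * R + 3) A f \<Longrightarrow>
     \<bar>(\<integral>s. f (x - s) * \<psi> s \<partial>lborel) - (\<integral>s. f (y - s) * \<psi> s \<partial>lborel)\<bar>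
       \<le> C * A * min 1 \<bar>x - y\<bar> * (qdecay x + qdecay y)"
    by blast
  \<comment> \<open>\<open>c3\<close> and \<open>c4\<close> are the coefficients of the third and
    fourth derivatives of y^\<kappa>. \<open>A1\<close> dominates the power on y \<le> 3R + 3 and
    every coefficient up to 6. In \<open>A2\<close> the first summand bounds the difference of two
    powers on that range, the second the derivatives of the difference.\<close>
  define c3 c4 where "c3 \<kappa> = \<kappa> * (\<kappa> - 1) * (\<kappa> - 2)" and "c4 \<kappa> = \<kappa> * (\<kappa> - 1) * (\<kappa> - 2) * (\<kappa> - 3)" for \<kappa> :: real
  define A1 where "A1 = 3 * R + 9"
  define A2 where "A2 = (3 * R + 3) / \<delta> + 35 * (1 + 1/\<delta>)"
  have "A1 > 0" using R by (simp add: A1_def)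
  moreover have "(3 * R + 3) / \<delta> + 35 * (1 + 1 / \<delta>) > 0" using R \<delta> by (simp add: field_simps add_pos_pos)
  then have "A2 > 0" unfolding A2_def .
  ultimately have A0: "A1 > 0" "A2 > 0" by auto
  have c3: "\<bar>c3 \<kappa>\<bar> \<le> 2" if "\<kappa> \<in> {\<delta>..1-\<delta>}" for \<kappa>
  proof -
    have "\<bar>c3 \<kappa>\<bar> \<le> 1 * 1 * 2" unfolding c3_def abs_mult by (intro mult_mono) (use that \<delta> in auto)
    then show ?thesis by simp
  qed
  have c4: "\<bar>c4 \<kappa>\<bar> \<le> 6" if "\<kappa> \<in> {\<delta>..1-\<delta>}" for \<kappa>
  proof -
    have "\<bar>c4 \<kappa>\<bar> \<le> 1 * 1 * 2 * 3" unfolding c4_def abs_mult by (intro mult_mono) (use that \<delta> in auto)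
    then show ?thesis by simp
  qed
  \<comment> \<open>Factoring out \<kappa> - \<kappa>' leaves a cofactor of size at most 3 + 6 + 2 =
    11 on [0, 1]. Since \<open>c4\<close> is \<open>c3\<close> times \<kappa> - 3, its constant
    becomes 11 * 3 + 2 = 35.\<close>
  have c3d: "\<bar>c3 \<kappa> - c3 \<kappa>'\<bar> \<le> 11 * \<bar>\<kappa> - \<kappa>'\<bar>" if k: "\<kappa> \<in> {\<delta>..1-\<delta>}" "\<kappa>' \<in> {\<delta>..1-\<delta>}" for \<kappa> \<kappa>'
  proof -
    have lin: "\<bar>a + b + c - 3 * (x + y) + 2\<bar> \<le> 11"
      if "0 \<le> a" "a \<le> 1" "0 \<le> b" "b \<le> 1" "0 \<le> c" "c \<le> 1" "0 \<le> x" "x \<le> 1" "0 \<le> y" "y \<le> 1" for a b c x y :: real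
      using that by (smt (verit))
    have k1: "0 \<le> \<kappa>" "\<kappa> \<le> 1" "0 \<le> \<kappa>'" "\<kappa>' \<le> 1" using k \<delta> by auto
    have "c3 \<kappa> - c3 \<kappa>' = (\<kappa>^2 + \<kappa> * \<kappa>' + \<kappa>'^2 - 3 * (\<kappa> + \<kappa>') + 2) * (\<kappa> - \<kappa>')"
      by (simp add: c3_def algebra_simps power2_eq_square)
    moreover have "0 \<le> \<kappa>^2" "\<kappa>^2 \<le> 1" "0 \<le> \<kappa>'^2" "\<kappa>'^2 \<le> 1" "0 \<le> \<kappa> * \<kappa>'" "\<kappa> * \<kappa>' \<le> 1"
      using k1 by (auto intro!: power_le_one mult_le_one)
    then have "\<bar>\<kappa>^2 + \<kappa> * \<kappa>' + \<kappa>'^2 - 3 * (\<kappa> + \<kappa>') + 2\<bar> \<le> 11"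
      using lin k1 by blast
    ultimately show ?thesis by (simp add: abs_mult mult_right_mono)
  qed
  have c4d: "\<bar>c4 \<kappa> - c4 \<kappa>'\<bar> \<le> 35 * \<bar>\<kappa> - \<kappa>'\<bar>" if k: "\<kappa> \<in> {\<delta>..1-\<delta>}" "\<kappa>' \<in> {\<delta>..1-\<delta>}" for \<kappa> \<kappa>'
  proof -
    have "\<bar>c4 \<kappa> - c4 \<kappa>'\<bar> = \<bar>(c3 \<kappa> - c3 \<kappa>') * (\<kappa> - 3) + c3 \<kappa>' * (\<kappa> - \<kappa>')\<bar>"
      by (simp add: c3_def c4_def algebra_simps)
    also have "\<dots> \<le> \<bar>c3 \<kappa> - c3 \<kappa>'\<bar> * \<bar>\<kappa> - 3\<bar> + \<bar>c3 \<kappa>'\<bar> * \<bar>\<kappa> - \<kappa>'\<bar>"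
      unfolding abs_mult[symmetric] by (rule abs_triangle_ineq)
    also have "\<dots> \<le> (11 * \<bar>\<kappa> - \<kappa>'\<bar>) * 3 + 2 * \<bar>\<kappa> - \<kappa>'\<bar>"
      by (intro add_mono mult_mono c3d c3 k) (use k \<delta> in auto)
    finally show ?thesis by simp
  qed
  have D: "((\<lambda>y. \<kappa> * y powr (\<kappa> - 1)) has_real_derivative \<kappa> * (\<kappa> - 1) * y powr (\<kappa> - 2)) (at y)"
     "((\<lambda>y. \<kappa> * (\<kappa> - 1) * y powr (\<kappa> - 2)) has_real_derivative c3 \<kappa> * y powr (\<kappa> - 3)) (at y)"
     "((\<lambda>y. c3 \<kappa> * y powr (\<kappa> - 3)) has_real_derivative c4 \<kappa> * y powr (\<kappa> - 4)) (at y)"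
    if "y \<ge> 1" for y \<kappa> :: real
    using powr_mult_derivative[OF that, of \<kappa> \<kappa> 1] powr_mult_derivative[OF that, of "\<kappa> * (\<kappa> - 1)" \<kappa> 2]
      powr_mult_derivative[OF that, of "c3 \<kappa>" \<kappa> 3] by (auto simp: c3_def c4_def)
  have powr_le: "\<bar>b * y powr (\<kappa> - n)\<bar> \<le> A1 / y^2"
    if "\<kappa> \<in> {\<delta>..1-\<delta>}" "y \<ge> 1" "n \<ge> 3" "\<bar>b\<bar> \<le> 6" for b y n \<kappa> :: real
  proof -
    have "\<bar>b * y powr (\<kappa> - n)\<bar> \<le> A1 * y powr (-2)"
      unfolding abs_mult by (intro mult_mono) (use that \<delta> R in \<open>auto simp: A1_def intro!: powr_mono\<close>)
    also have "\<dots> = A1 / y^2" using that by (simp add: powr_minus powr_numeral divide_inverse)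
    finally show ?thesis .
  qed
  have pos: "0 < \<kappa>" if "\<kappa> \<in> {\<delta>..1-\<delta>}" for \<kappa> using that \<delta> by auto
  have 1: "\<bar>Psi \<psi> \<alpha> x v - Psi \<psi> \<alpha> y v\<bar> \<le> C * A1 * min 1 \<bar>x - y\<bar> * (qdecay x + qdecay y)"
    if v: "v - 1/\<alpha> \<in> {\<delta>..1-\<delta>}" for v x y
    unfolding Psi_def
  proof (rule C, unfold regular_kernel_def, intro conjI exI)
    show "continuous_on UNIV (\<lambda>y. pospow y (v - 1/\<alpha>))" by (rule continuous_pospow[OF pos[OF v]])
    show "\<forall>y\<le>0. pospow y (v - 1/\<alpha>) = 0" by (simp add: pospow_def)
    have "\<bar>pospow y (v - 1/\<alpha>)\<bar> \<le> A1" if "y \<le> 3 * R + 3" for y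
      using powr_le_max[of "v - 1/\<alpha>" y] pos[OF v] v \<delta> that R
      by (cases "y > 0") (auto simp: pospow_def A1_def max_def split: if_splits)
    then show "\<forall>y\<le>3 * R + 3. \<bar>pospow y (v - 1/\<alpha>)\<bar> \<le> A1" by blast
    have "\<bar>c3 (v - 1/\<alpha>)\<bar> \<le> 6" using c3[OF v] by simp
    then show "\<forall>y\<ge>1. ((\<lambda>y. pospow y (v - 1/\<alpha>)) has_real_derivative (v - 1/\<alpha>) * y powr ((v - 1/\<alpha>) - 1)) (at y) \<and>
        ((\<lambda>y. (v - 1/\<alpha>) * y powr ((v - 1/\<alpha>) - 1)) has_real_derivative (v - 1/\<alpha>) * ((v - 1/\<alpha>) - 1) * y powr ((v - 1/\<alpha>) - 2)) (at y) \<and>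
        ((\<lambda>y. (v - 1/\<alpha>) * ((v - 1/\<alpha>) - 1) * y powr ((v - 1/\<alpha>) - 2)) has_real_derivative c3 (v - 1/\<alpha>) * y powr ((v - 1/\<alpha>) - 3)) (at y) \<and>
        ((\<lambda>y. c3 (v - 1/\<alpha>) * y powr ((v - 1/\<alpha>) - 3)) has_real_derivative c4 (v - 1/\<alpha>) * y powr ((v - 1/\<alpha>) - 4)) (at y) \<and>
        \<bar>c3 (v - 1/\<alpha>) * y powr ((v - 1/\<alpha>) - 3)\<bar> \<le> A1 / y^2 \<and> \<bar>c4 (v - 1/\<alpha>) * y powr ((v - 1/\<alpha>) - 4)\<bar> \<le> A1 / y^2"
      by (intro allI impI conjI pospow_derivative D powr_le v c4[OF v]) auto
  qed
  have 2: "\<bar>(Psi \<psi> \<alpha> x v - Psi \<psi> \<alpha> x v') - (Psi \<psi> \<alpha> y v - Psi \<psi> \<alpha> y v')\<bar>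
         \<le> C * (A2 * \<bar>v - v'\<bar>) * min 1 \<bar>x - y\<bar> * (qdecay x + qdecay y)"
    if v: "v - 1/\<alpha> \<in> {\<delta>..1-\<delta>}" and v': "v' - 1/\<alpha> \<in> {\<delta>..1-\<delta>}" for v v' x y
  proof -
    define \<kappa> \<kappa>' where k: "\<kappa> = v - 1/\<alpha>" "\<kappa>' = v' - 1/\<alpha>"
    note vk = v[folded k] v'[folded k]
    have P: "Psi \<psi> \<alpha> x v - Psi \<psi> \<alpha> x v' = (\<integral>s. (pospow (x - s) \<kappa> - pospow (x - s) \<kappa>') * \<psi> s \<partial>lborel)" for x
    proof -
      have "integrable lborel (\<lambda>s. pospow (x - s) \<kappa> * \<psi> s)" "integrable lborel (\<lambda>s. pospow (x - s) \<kappa>' * \<psi> s)"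
        by (intro integrable_mult_compact_support[OF _ c supp]
            continuous_on_compose2[OF continuous_pospow] continuous_intros pos vk; simp)+
      then show ?thesis by (simp add: Psi_def k left_diff_distrib)
    qed
    have dk: "\<bar>v - v'\<bar> = \<bar>\<kappa> - \<kappa>'\<bar>" by (simp add: k)
    have "\<bar>(\<integral>s. (pospow (x - s) \<kappa> - pospow (x - s) \<kappa>') * \<psi> s \<partial>lborel) -
        (\<integral>s. (pospow (y - s) \<kappa> - pospow (y - s) \<kappa>') * \<psi> s \<partial>lborel)\<bar>
      \<le> C * (A2 * \<bar>\<kappa> - \<kappa>'\<bar>) * min 1 \<bar>x - y\<bar> * (qdecay x + qdecay y)"
    proof (rule C, unfold regular_kernel_def, intro conjI exI)
      show "continuous_on UNIV (\<lambda>y. pospow y \<kappa> - pospow y \<kappa>')"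
        by (intro continuous_intros continuous_pospow pos vk)
      show "\<forall>y\<le>0. pospow y \<kappa> - pospow y \<kappa>' = 0" by (simp add: pospow_def)
      have "\<bar>pospow y \<kappa> - pospow y \<kappa>'\<bar> \<le> A2 * \<bar>\<kappa> - \<kappa>'\<bar>" if y: "y \<le> 3 * R + 3" for y
      proof (cases "y > 0")
        case True
        have "\<bar>pospow y \<kappa> - pospow y \<kappa>'\<bar> \<le> max 1 y / \<delta> * \<bar>\<kappa> - \<kappa>'\<bar>"
          using powr_exponent_Lipschitz[OF \<delta> vk True] True by (simp add: pospow_def)
        also have "\<dots> \<le> A2 * \<bar>\<kappa> - \<kappa>'\<bar>"
        proof (intro mult_right_mono)
          have "max 1 y / \<delta> \<le> (3 * R + 3) / \<delta>" by (intro divide_right_mono) (use y R \<delta> in auto)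
          then show "max 1 y / \<delta> \<le> A2" using \<delta> by (simp add: A2_def add_increasing2)
        qed auto
        finally show ?thesis .
      qed (use A0 in \<open>auto simp: pospow_def\<close>)
      then show "\<forall>y\<le>3 * R + 3. \<bar>pospow y \<kappa> - pospow y \<kappa>'\<bar> \<le> A2 * \<bar>\<kappa> - \<kappa>'\<bar>" by blast
      have h: "\<bar>b * y powr (\<kappa> - n) - b' * y powr (\<kappa>' - n)\<bar> \<le> A2 * \<bar>\<kappa> - \<kappa>'\<bar> / y^2"
        if y: "y \<ge> 1" and n: "n \<ge> 3" and b: "\<bar>b - b'\<bar> \<le> 35 * \<bar>\<kappa> - \<kappa>'\<bar>" "\<bar>b'\<bar> \<le> 35" for b b' y n :: real
      proof -
        have "\<bar>b * y powr (\<kappa> - n) - b' * y powr (\<kappa>' - n)\<bar> \<le> 35 * (1 + 1/\<delta>) * \<bar>\<kappa> - \<kappa>'\<bar> / y^2"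
          by (rule powr_coeff_Lipschitz[OF \<delta> vk y b n])
        also have "\<dots> \<le> A2 * \<bar>\<kappa> - \<kappa>'\<bar> / y^2"
          by (intro divide_right_mono mult_right_mono) (use R \<delta> in \<open>auto simp: A2_def\<close>)
        finally show ?thesis .
      qed
      have b: "\<bar>c3 \<kappa> - c3 \<kappa>'\<bar> \<le> 35 * \<bar>\<kappa> - \<kappa>'\<bar>" "\<bar>c3 \<kappa>'\<bar> \<le> 35" "\<bar>c4 \<kappa>'\<bar> \<le> 35"
        using c3d[OF vk] c3[OF vk(2)] c4[OF vk(2)] by auto
      show "\<forall>y\<ge>1. ((\<lambda>y. pospow y \<kappa> - pospow y \<kappa>') has_real_derivative \<kappa> * y powr (\<kappa> - 1) - \<kappa>' * y powr (\<kappa>' - 1)) (at y) \<and>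
        ((\<lambda>y. \<kappa> * y powr (\<kappa> - 1) - \<kappa>' * y powr (\<kappa>' - 1)) has_real_derivative \<kappa> * (\<kappa> - 1) * y powr (\<kappa> - 2) - \<kappa>' * (\<kappa>' - 1) * y powr (\<kappa>' - 2)) (at y) \<and>
        ((\<lambda>y. \<kappa> * (\<kappa> - 1) * y powr (\<kappa> - 2) - \<kappa>' * (\<kappa>' - 1) * y powr (\<kappa>' - 2)) has_real_derivative c3 \<kappa> * y powr (\<kappa> - 3) - c3 \<kappa>' * y powr (\<kappa>' - 3)) (at y) \<and>
        ((\<lambda>y. c3 \<kappa> * y powr (\<kappa> - 3) - c3 \<kappa>' * y powr (\<kappa>' - 3)) has_real_derivative c4 \<kappa> * y powr (\<kappa> - 4) - c4 \<kappa>' * y powr (\<kappa>' - 4)) (at y) \<and>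
        \<bar>c3 \<kappa> * y powr (\<kappa> - 3) - c3 \<kappa>' * y powr (\<kappa>' - 3)\<bar> \<le> A2 * \<bar>\<kappa> - \<kappa>'\<bar> / y^2 \<and>
        \<bar>c4 \<kappa> * y powr (\<kappa> - 4) - c4 \<kappa>' * y powr (\<kappa>' - 4)\<bar> \<le> A2 * \<bar>\<kappa> - \<kappa>'\<bar> / y^2"
        by (intro allI impI conjI DERIV_diff pospow_derivative D h b c4d vk) auto
    qed
    then show ?thesis unfolding P dk .
  qed
  define K where "K = C * max A1 A2"
  have q: "0 \<le> min 1 \<bar>x - y\<bar> * (qdecay x + qdecay y)" for x y
    using less_imp_le[OF qdecay_pos, of x] less_imp_le[OF qdecay_pos, of y] by auto
  show thesis
  proof (rule that[of K])
    show "K > 0" using C0 A0 by (simp add: K_def)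
    fix v x y :: real assume v: "v - 1/\<alpha> \<in> {\<delta>..1-\<delta>}"
    have "(C * A1) * (min 1 \<bar>x - y\<bar> * (qdecay x + qdecay y)) \<le> K * (min 1 \<bar>x - y\<bar> * (qdecay x + qdecay y))"
      by (intro mult_right_mono q) (use C0 in \<open>auto simp: K_def\<close>)
    then show "\<bar>Psi \<psi> \<alpha> x v - Psi \<psi> \<alpha> y v\<bar> \<le> K * min 1 \<bar>x - y\<bar> * (qdecay x + qdecay y)"
      using 1[OF v, of x y] by (simp add: mult.assoc)
  next
    fix v v' x y :: real assume v: "v - 1/\<alpha> \<in> {\<delta>..1-\<delta>}" "v' - 1/\<alpha> \<in> {\<delta>..1-\<delta>}"
    have "(C * A2) * (\<bar>v - v'\<bar> * (min 1 \<bar>x - y\<bar> * (qdecay x + qdecay y))) \<le> K * (\<bar>v - v'\<bar> * (min 1 \<bar>x - y\<bar> * (qdecay x + qdecay y)))"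
      by (intro mult_right_mono mult_nonneg_nonneg[OF _ q]) (use C0 in \<open>auto simp: K_def\<close>)
    then show "\<bar>(Psi \<psi> \<alpha> x v - Psi \<psi> \<alpha> x v') - (Psi \<psi> \<alpha> y v - Psi \<psi> \<alpha> y v')\<bar>
         \<le> K * \<bar>v - v'\<bar> * min 1 \<bar>x - y\<bar> * (qdecay x + qdecay y)"
      using 2[OF v, of x y] by (simp add: mult.assoc)
  qed
qed

section \<open>Lattice and scale sums\<close>

lemma summable_on_int_abs:
  fixes g :: "nat \<Rightarrow> real"
  assumes "summable g" "\<And>n. g n \<ge> 0"
  shows "(\<lambda>m::int. g (nat \<bar>m\<bar>)) summable_on UNIV"
proof -
  have g: "g summable_on UNIV"
    using assms by (intro norm_summable_imp_summable_on) simp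
  have "(\<lambda>m::int. g (nat \<bar>m\<bar>)) summable_on range int"
    using g by (subst summable_on_reindex) (auto simp: o_def)
  moreover have "(\<lambda>m::int. g (nat \<bar>m\<bar>)) summable_on range (\<lambda>n. - int n)"
    using g by (subst summable_on_reindex) (auto simp: o_def inj_on_def)
  then have "(\<lambda>m::int. g (nat \<bar>m\<bar>)) summable_on (range (\<lambda>n. - int n) - range int)"
    by (rule summable_on_subset_banach) auto
  ultimately have "(\<lambda>m::int. g (nat \<bar>m\<bar>)) summable_on (range int \<union> (range (\<lambda>n. - int n) - range int))"
    by (rule summable_on_Un_disjoint) auto
  moreover have "range int \<union> (range (\<lambda>n. - int n) - range int) = UNIV"
  proof -
    have "m \<in> range int \<or> m \<in> range (\<lambda>n. - int n)" for m :: int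
      by (cases m rule: int_cases2) auto
    then show ?thesis by auto
  qed
  ultimately show ?thesis by simp
qed

lemma summable_shifted_powr:
  assumes "r > (1::real)" "c \<ge> 1" shows "summable (\<lambda>n. (c + real n) powr (-r))"
proof -
  have "summable (\<lambda>n. real (Suc n) powr (-r))"
    using assms summable_Suc_iff[of "\<lambda>n. real n powr (-r)"] by (simp add: summable_real_powr_iff)
  then show ?thesis
    by (rule summable_comparison_test[rotated]) (use assms in \<open>auto intro!: exI[of _ 0] powr_mono2'\<close>)
qed

text \<open>Uniformity in x matters because x will be 2^j u for every scale j. Replacing x by its
  floor changes distances to integers by at most 1, which costs 2^r, and the sum centred at an
  integer is translation invariant.\<close>

lemma uniform_lattice_sum:
  assumes r: "r > (1::real)"
  shows "\<exists>Q>0. \<forall>x::real. (\<lambda>k::int. (1 + \<bar>x - of_int k\<bar>) powr (-r)) summable_on UNIV \<and>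
    (\<Sum>\<^sub>\<infinity>k::int. (1 + \<bar>x - of_int k\<bar>) powr (-r)) \<le> Q"
proof -
  define p where "p m = (1 + \<bar>real_of_int m\<bar>) powr (-r)" for m
  have p: "p summable_on UNIV"
    using summable_on_int_abs[OF summable_shifted_powr[OF r, of 1]] by (simp add: p_def[abs_def])
  define Q where "Q = 2 powr r * infsum p UNIV + 1"
  have "infsum p UNIV \<ge> 0" by (rule infsum_nonneg) (simp add: p_def)
  then have Q: "Q > 0" by (auto simp: Q_def intro!: add_nonneg_pos)
  show ?thesis
  proof (intro exI conjI allI)
    show "Q > 0" by fact
    fix x :: real
    have bij: "bij_betw (\<lambda>k. \<lfloor>x\<rfloor> - k) UNIV (UNIV :: int set)"
      by (rule bij_betwI[where g = "\<lambda>k. \<lfloor>x\<rfloor> - k"]) auto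
    have s: "(\<lambda>k. 2 powr r * p (\<lfloor>x\<rfloor> - k)) summable_on UNIV"
      using summable_on_reindex_bij_betw[OF bij, of p] p by (intro summable_on_cmult_right) auto
    have half: "(1 + m) / 2 \<le> 1 + \<bar>t\<bar>" if "m \<le> \<bar>t\<bar> + 1" for m t :: real
    proof -
      have "1 + m \<le> 2 * (1 + \<bar>t\<bar>)" using that abs_ge_zero[of t] by (smt (verit))
      then show ?thesis by simp
    qed
    have le: "(1 + \<bar>x - of_int k\<bar>) powr (-r) \<le> 2 powr r * p (\<lfloor>x\<rfloor> - k)" for k
    proof -
      have "\<bar>real_of_int (\<lfloor>x\<rfloor> - k)\<bar> \<le> \<bar>x - of_int k\<bar> + 1"
        unfolding of_int_diff by linarith
      then have "(1 + \<bar>real_of_int (\<lfloor>x\<rfloor> - k)\<bar>) / 2 \<le> 1 + \<bar>x - of_int k\<bar>"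
        by (rule half)
      then have "(1 + \<bar>x - of_int k\<bar>) powr (-r) \<le> ((1 + \<bar>real_of_int (\<lfloor>x\<rfloor> - k)\<bar>) / 2) powr (-r)"
        by (intro powr_mono2') (use r in auto)
      also have "\<dots> = 2 powr r * p (\<lfloor>x\<rfloor> - k)"
        by (simp add: p_def powr_divide powr_minus_divide[of 2] mult.commute)
      finally show ?thesis .
    qed
    show sx: "(\<lambda>k::int. (1 + \<bar>x - of_int k\<bar>) powr (-r)) summable_on UNIV"
      by (rule summable_on_comparison_test[OF s]) (use le in auto)
    have "(\<Sum>\<^sub>\<infinity>k::int. (1 + \<bar>x - of_int k\<bar>) powr (-r)) \<le> (\<Sum>\<^sub>\<infinity>k. 2 powr r * p (\<lfloor>x\<rfloor> - k))"
      by (rule infsum_mono[OF sx s]) (rule le)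
    also have "\<dots> = 2 powr r * (\<Sum>\<^sub>\<infinity>k. p (\<lfloor>x\<rfloor> - k))" by (rule infsum_cmult_right')
    also have "(\<Sum>\<^sub>\<infinity>k. p (\<lfloor>x\<rfloor> - k)) = infsum p UNIV"
      by (rule infsum_reindex_bij_betw[OF bij])
    finally show "(\<Sum>\<^sub>\<infinity>k::int. (1 + \<bar>x - of_int k\<bar>) powr (-r)) \<le> Q" by (simp add: Q_def)
  qed
qed

text \<open>The square leaves room for two linear factors in j: one from the coefficients at coarse
  scales, one from differentiating 2^(-jv) in v.\<close>

lemma summable_quadratic_exponential:
  assumes "\<delta> > (0::real)"
  shows "(\<lambda>j::int. (3 + \<bar>real_of_int j\<bar>)^2 * 2 powr (- \<delta> * \<bar>real_of_int j\<bar>)) summable_on UNIV"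
proof -
  \<comment> \<open>The two bounds on \<open>d\<close> give d(3 + n) \<le> 1 + (\<delta> ln 2 / 4)
    n, which is below an exponential whose fourth power is 2^(\<delta> n). Four powers gained
    against two present leave the summable (3 + n)^(-2).\<close>
  define d where "d = min (1/3) (\<delta> * ln 2 / 4)"
  have d: "d > 0" "d \<le> 1/3" "d \<le> \<delta> * ln 2 / 4" using assms by (auto simp: d_def)
  have "summable (\<lambda>n. (1 / d^4) * (3 + real n) powr (-2))"
    by (intro summable_mult summable_shifted_powr) auto
  then have "summable (\<lambda>n. (3 + real n)^2 * 2 powr (- \<delta> * real n))"
  proof (rule summable_comparison_test[rotated], intro exI[of _ 0] allI impI)
    fix n
    have pos: "3 + real n > 0" by simp
    have "d * (3 + real n) \<le> 1 + (\<delta> * ln 2 / 4) * real n"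
      using d mult_right_mono[OF d(3), of "real n"] by (simp add: algebra_simps)
    also have "\<dots> \<le> exp ((\<delta> * ln 2 / 4) * real n)" by (rule exp_ge_add_one_self)
    finally have "(d * (3 + real n))^4 \<le> exp ((\<delta> * ln 2 / 4) * real n)^4"
      by (intro power_mono) (use d in auto)
    also have "\<dots> = 2 powr (\<delta> * real n)"
      by (simp add: exp_of_nat_mult[symmetric] powr_def mult_ac)
    finally have "1 / 2 powr (\<delta> * real n) \<le> 1 / (d * (3 + real n))^4"
      by (intro divide_left_mono mult_pos_pos zero_less_power) (use d pos in auto)
    then have "(3 + real n)^2 * (1 / 2 powr (\<delta> * real n)) \<le> (3 + real n)^2 * (1 / (d * (3 + real n))^4)"
      by (intro mult_left_mono) auto
    also have "\<dots> = (1 / d^4) * (1 / (3 + real n)^2)"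
      using pos d by (simp add: power_mult_distrib power4_eq_xxxx power2_eq_square)
    finally show "norm ((3 + real n)^2 * 2 powr (- \<delta> * real n)) \<le> (1 / d^4) * (3 + real n) powr (-2)"
      using pos by (simp add: powr_minus divide_inverse powr_numeral del: of_nat_add)
  qed
  from summable_on_int_abs[OF this] show ?thesis by simp
qed

text \<open>Domination by a nonnegative scale-times-profile array permits summing over k first,
  uniformly in j. Summability is stated separately because \<open>infsum\<close> defaults to 0
  without it, and the field increments must be differences of genuine sums.\<close>

lemma double_sum_bound:
  fixes T :: "int \<times> int \<Rightarrow> real"
  assumes T: "\<And>j k. \<bar>T (j, k)\<bar> \<le> A j * P j k"
    and A: "\<And>j. A j \<ge> 0" "A summable_on UNIV"
    and P: "\<And>j k. P j k \<ge> 0" "\<And>j. P j summable_on UNIV" "\<And>j. infsum (P j) UNIV \<le> Q"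
  shows "T summable_on UNIV" "\<bar>infsum T UNIV\<bar> \<le> Q * infsum A UNIV"
proof -
  define G where "G = (\<lambda>(j, k). A j * P j k)"
  have in0: "infsum (P j) UNIV \<ge> 0" for j by (rule infsum_nonneg) (use P in auto)
  have i: "(\<Sum>\<^sub>\<infinity>k. G (j, k)) = A j * infsum (P j) UNIV" for j
    unfolding G_def by (simp add: infsum_cmult_right')
  have s: "(\<lambda>j. A j * infsum (P j) UNIV) summable_on UNIV"
  proof (rule summable_on_comparison_test)
    show "(\<lambda>j. A j * Q) summable_on UNIV" by (intro summable_on_cmult_left A)
  qed (use A P in0 in \<open>auto intro!: mult_left_mono\<close>)
  have nG: "norm (G x) = G x" for x using A P by (auto simp: G_def split: prod.splits)
  have Gabs: "(\<lambda>x. norm (G x)) summable_on (UNIV \<times> UNIV)"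
  proof (rule Infinite_Sum.abs_summable_on_Sigma_iff[THEN iffD2], intro conjI ballI)
    show "(\<lambda>k. norm (G (j, k))) summable_on UNIV" for j
      unfolding nG using P by (auto simp: G_def intro!: summable_on_cmult_right)
    show "(\<lambda>j. norm (\<Sum>\<^sub>\<infinity>k. norm (G (j, k)))) summable_on UNIV"
      unfolding nG i using s A in0 by simp
  qed
  then have Gs: "G summable_on UNIV" unfolding nG by simp
  have le: "norm (T x) \<le> G x" for x using T by (cases x) (auto simp: G_def)
  have Tabs: "(\<lambda>x. norm (T x)) summable_on UNIV"
    by (rule Infinite_Sum.abs_summable_on_comparison_test[where g = G]) (use Gabs le nG in auto)
  then show "T summable_on UNIV" by (rule abs_summable_summable)
  have "norm (infsum T UNIV) \<le> (\<Sum>\<^sub>\<infinity>x. norm (T x))" by (rule norm_infsum_bound[OF Tabs])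
  also have "\<dots> \<le> infsum G UNIV" by (rule infsum_mono[OF Tabs Gs le])
  also have "\<dots> = (\<Sum>\<^sub>\<infinity>j. \<Sum>\<^sub>\<infinity>k. G (j, k))"
    using infsum_Sigma_banach[of G UNIV "\<lambda>_. UNIV"] Gs by simp
  also have "\<dots> = (\<Sum>\<^sub>\<infinity>j. A j * infsum (P j) UNIV)" by (simp only: i)
  also have "\<dots> \<le> (\<Sum>\<^sub>\<infinity>j. Q * A j)"
  proof (rule infsum_mono[OF s])
    show "(\<lambda>j. Q * A j) summable_on UNIV" by (intro summable_on_cmult_right A)
    show "A j * infsum (P j) UNIV \<le> Q * A j" for j
      using mult_left_mono[OF P(3) A(1)] by (simp add: mult.commute)
  qed
  also have "\<dots> = Q * infsum A UNIV" by (rule infsum_cmult_right')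
  finally show "\<bar>infsum T UNIV\<bar> \<le> Q * infsum A UNIV" by simp
qed

section \<open>Size of the random coefficients at each scale\<close>

text \<open>This is the growth in j that remains after the dependence on k is absorbed: the rate of
  \<open>Omega1_prop\<close> at fine scales, and at coarse ones the factor of
  \<open>Omega0_prop\<close> with its power rounded up to 1.\<close>

definition scale_weight :: "real \<Rightarrow> int \<Rightarrow> real" where
  "scale_weight \<alpha> j = (if j \<ge> 0 then 2 powr (of_int j / \<alpha>) else 3 + \<bar>of_int j\<bar>)"

lemma scale_weight_pos: "scale_weight \<alpha> j > 0"
  by (auto simp: scale_weight_def)

text \<open>At fine scales \<open>Omega1_prop\<close> controls the wavelets located near \<open>{-L..L}\<close>;
  for the distant ones the decay in \<open>k\<close> compensates the cruder bound \<open>Omega0_prop\<close>.\<close>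
lemma coefficient_decay:
  assumes \<alpha>: "1 < \<alpha>" and O0: "Omega0_prop \<alpha> e" and O1: "Omega1_prop \<alpha> e" and L: "L \<ge> 0"
  obtains C r where "C > 0" "r > 1"
    "\<And>j k u. \<bar>u\<bar> \<le> L \<Longrightarrow> \<bar>e j k\<bar> * qdecay (2 powr of_int j * u - of_int k)
      \<le> C * scale_weight \<alpha> j * ((1 + \<bar>2 powr of_int j * u - of_int k\<bar>) powr (-r) + (1 + \<bar>of_int k\<bar>) powr (-r))"
proof -
  \<comment> \<open>Half of the gap between 1/\<alpha> and 1 is spent on \<open>\<eta>\<close>, so
    \<open>\<rho>\<close> is still below 1 and the net decay \<open>r\<close> above 1.\<close>
  define \<eta> \<rho> r where "\<eta> = (1 - 1/\<alpha>) / 2" and "\<rho> = 1/\<alpha> + \<eta>" and "r = 2 - \<rho>"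
  have a1: "0 < 1/\<alpha>" "1/\<alpha> < 1" using \<alpha> by auto
  then have \<eta>: "\<eta> > 0" by (simp add: \<eta>_def)
  have "0 < \<rho>" using a1 \<eta> unfolding \<rho>_def by linarith
  moreover have "\<rho> < 1" using \<alpha> by (simp add: \<rho>_def \<eta>_def field_simps)
  ultimately have \<rho>: "0 < \<rho>" "\<rho> < 1" by auto
  have r: "1 < r" "r < 2" using \<rho> by (auto simp: r_def)
  obtain C0 where C0: "C0 > 0" and e0: "\<And>j k. \<bar>e j k\<bar> \<le> C0 * (3 + \<bar>real_of_int j\<bar>) powr \<rho> * (3 + \<bar>real_of_int k\<bar>) powr \<rho>"
    using O0 \<eta> unfolding Omega0_prop_def \<rho>_def by blast
  \<comment> \<open>The radius for \<open>Omega1_prop\<close> is large enough that any k beyond it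
    satisfies |k| \<ge> 2 * 2^j L; then 2^j u is at most |k|/2 in size, and |k| \<le> 2 |2^j u -
    k|.\<close>
  have "2 * L + 1 > 0" using L by simp
  then obtain C1 where C1: "C1 > 0" and e1: "\<And>j k. j \<ge> 0 \<Longrightarrow> \<bar>real_of_int k\<bar> * 2 powr (- real_of_int j) \<le> 2 * L + 1 \<Longrightarrow>
      \<bar>e j k\<bar> \<le> C1 * 2 powr (real_of_int j / \<alpha>)"
    using O1 unfolding Omega1_prop_def by blast
  \<comment> \<open>\<open>K\<close> absorbs 3 + j into 2^(j/\<alpha>) for j \<ge> 0. The summands
    of \<open>C\<close> belong to the near, the remote and the coarse case; 12 is 3 * 2^2 from
    \<open>scaled\<close>.\<close>
  define K where "K = 3 + \<alpha> / ln 2"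
  have K: "K > 0" using \<alpha> by (auto simp: K_def intro!: add_pos_pos)
  define C where "C = C1 + 12 * C0 * K + C0 * (3 + L)"
  have C: "C > 0" "C1 \<le> C" "12 * C0 * K \<le> C" "C0 * (3 + L) \<le> C"
    using C0 C1 K L by (auto simp: C_def add_nonneg_nonneg add_pos_nonneg)
  have e0': "\<bar>e j k\<bar> \<le> C0 * (3 + \<bar>real_of_int j\<bar>) * (3 + \<bar>real_of_int k\<bar>) powr \<rho>" for j k
  proof -
    have "(3 + \<bar>real_of_int j\<bar>) powr \<rho> \<le> (3 + \<bar>real_of_int j\<bar>) powr 1"
      by (intro powr_mono) (use \<rho> in auto)
    then have "C0 * (3 + \<bar>real_of_int j\<bar>) powr \<rho> * (3 + \<bar>real_of_int k\<bar>) powr \<rho>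
        \<le> C0 * (3 + \<bar>real_of_int j\<bar>) * (3 + \<bar>real_of_int k\<bar>) powr \<rho>"
      by (intro mult_right_mono mult_left_mono) (use C0 in auto)
    then show ?thesis using e0[of j k] by linarith
  qed
  \<comment> \<open>Growth \<rho> of the coefficient against decay 2 gives y^(-r). Here y is 1 + |x|
    at coarse scales (c = 3 + L, b = 1) and 1 + |k| for remote wavelets (c = 3, b = 2).\<close>
  have scaled: "(3 + \<bar>real_of_int k\<bar>) powr \<rho> * qdecay x \<le> c * b^2 * y powr (-r)"
    if "3 + \<bar>real_of_int k\<bar> \<le> c * y" "y \<le> b * (1 + \<bar>x\<bar>)" "y \<ge> 1" "c \<ge> 1" "b \<ge> 1" for k x c b y
  proof -
    have "(3 + \<bar>real_of_int k\<bar>) powr \<rho> \<le> (c * y) powr \<rho>"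
      by (intro powr_mono2) (use that \<rho> in auto)
    also have "\<dots> = c powr \<rho> * y powr \<rho>" using that by (simp add: powr_mult)
    also have "\<dots> \<le> c powr 1 * y powr \<rho>" by (intro mult_right_mono powr_mono) (use that \<rho> in auto)
    finally have 1: "(3 + \<bar>real_of_int k\<bar>) powr \<rho> \<le> c * y powr \<rho>" using that by simp
    have "y^2 \<le> b^2 * (1 + \<bar>x\<bar>)^2"
      using power_mono[OF that(2), of 2] that by (simp add: power_mult_distrib)
    then have 2: "qdecay x \<le> b^2 / y^2"
      using that by (simp add: qdecay_def field_simps)
    have "(3 + \<bar>real_of_int k\<bar>) powr \<rho> * qdecay x \<le> (c * y powr \<rho>) * (b^2 / y^2)"
      by (intro mult_mono 1 2) (use that less_imp_le[OF qdecay_pos] in auto)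
    also have "\<dots> = c * b^2 * y powr (-r)"
      using that by (simp add: r_def powr_diff powr_numeral)
    finally show ?thesis .
  qed
  have main: "\<bar>e j k\<bar> * qdecay x \<le> C * scale_weight \<alpha> j * ((1 + \<bar>x\<bar>) powr (-r) + (1 + \<bar>of_int k\<bar>) powr (-r))"
    if u: "\<bar>u\<bar> \<le> L" and x: "x = 2 powr of_int j * u - of_int k" for j k u x
  proof -
    note q0 = less_imp_le[OF qdecay_pos, of x]
    note s0 = less_imp_le[OF scale_weight_pos, of \<alpha> j]
    have bound: "2 powr of_int j * \<bar>u\<bar> \<le> 2 powr of_int j * L" using u by simp
    have au: "\<bar>2 powr of_int j * u\<bar> \<le> 2 powr of_int j * L" using bound by (simp add: abs_mult)
    consider "j < 0" | "j \<ge> 0" "\<bar>real_of_int k\<bar> * 2 powr (- real_of_int j) \<le> 2 * L + 1"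
      | "j \<ge> 0" "\<bar>real_of_int k\<bar> * 2 powr (- real_of_int j) > 2 * L + 1" by linarith
    then show ?thesis
    proof cases
      case 1
      have "2 powr of_int j \<le> 2 powr (0::real)" by (rule powr_mono) (use 1 in auto)
      then have "2 powr of_int j * L \<le> 1 * L" by (intro mult_right_mono) (use L in auto)
      then have "\<bar>real_of_int k\<bar> \<le> L + \<bar>x\<bar>" using au x by linarith
      moreover have "0 \<le> L * \<bar>x\<bar>" "(3 + L) * (1 + \<bar>x\<bar>) = 3 + L + 3 * \<bar>x\<bar> + L * \<bar>x\<bar>"
        using L by (auto simp: algebra_simps)
      ultimately have "3 + \<bar>real_of_int k\<bar> \<le> (3 + L) * (1 + \<bar>x\<bar>)"
        using abs_ge_zero[of x] by (smt (verit))
      then have "(3 + \<bar>real_of_int k\<bar>) powr \<rho> * qdecay x \<le> (3 + L) * 1^2 * (1 + \<bar>x\<bar>) powr (-r)"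
        by (rule scaled) (use L in auto)
      then have "(C0 * scale_weight \<alpha> j) * ((3 + \<bar>real_of_int k\<bar>) powr \<rho> * qdecay x)
          \<le> (C0 * scale_weight \<alpha> j) * ((3 + L) * (1 + \<bar>x\<bar>) powr (-r))"
        by (intro mult_left_mono) (use C0 s0 in auto)
      moreover have "\<bar>e j k\<bar> * qdecay x \<le> (C0 * scale_weight \<alpha> j * (3 + \<bar>real_of_int k\<bar>) powr \<rho>) * qdecay x"
        using e0'[of j k] 1 q0 by (intro mult_right_mono) (auto simp: scale_weight_def)
      moreover have "(C0 * (3 + L)) * scale_weight \<alpha> j * (1 + \<bar>x\<bar>) powr (-r)
        \<le> C * scale_weight \<alpha> j * ((1 + \<bar>x\<bar>) powr (-r) + (1 + \<bar>of_int k\<bar>) powr (-r))"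
        by (intro mult_mono C order_refl) (use s0 C in auto)
      ultimately show ?thesis by (simp add: mult_ac)
    next
      case 2
      have "qdecay x = (1 + \<bar>x\<bar>) powr (-2)"
        by (simp add: qdecay_def powr_minus powr_numeral divide_inverse)
      also have "\<dots> \<le> (1 + \<bar>x\<bar>) powr (-r)" using r by (intro powr_mono) auto
      finally have "qdecay x \<le> (1 + \<bar>x\<bar>) powr (-r) + (1 + \<bar>real_of_int k\<bar>) powr (-r)"
        by (rule order_trans) simp
      moreover have "\<bar>e j k\<bar> \<le> C * scale_weight \<alpha> j"
        using order_trans[OF e1[OF 2] mult_right_mono[OF C(2)]] 2(1) by (simp add: scale_weight_def)
      ultimately show ?thesis using q0 C s0 by (intro mult_mono) auto
    next
      case 3
      have "\<bar>real_of_int k\<bar> = (\<bar>real_of_int k\<bar> * 2 powr (- real_of_int j)) * 2 powr of_int j"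
        by (simp add: powr_minus)
      also have "\<dots> \<ge> (2 * L + 1) * 2 powr of_int j"
        by (intro mult_right_mono) (use 3 in auto)
      finally have "\<bar>real_of_int k\<bar> \<ge> 2 * (2 powr of_int j * L) + 2 powr of_int j" by (simp add: algebra_simps)
      moreover have "2 powr real_of_int j \<ge> 0" by simp
      ultimately have "2 * (2 powr of_int j * L) \<le> \<bar>real_of_int k\<bar>" by linarith
      then have "\<bar>real_of_int k\<bar> \<le> 2 * \<bar>x\<bar>" using au x by linarith
      then have "(3 + \<bar>real_of_int k\<bar>) powr \<rho> * qdecay x \<le> 3 * 2^2 * (1 + \<bar>real_of_int k\<bar>) powr (-r)"
        by (intro scaled) auto
      then have "(C0 * (3 + \<bar>real_of_int j\<bar>)) * ((3 + \<bar>real_of_int k\<bar>) powr \<rho> * qdecay x)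
          \<le> (C0 * (3 + \<bar>real_of_int j\<bar>)) * (12 * (1 + \<bar>real_of_int k\<bar>) powr (-r))"
        by (intro mult_left_mono) (use C0 in auto)
      also have "\<dots> \<le> (C0 * (K * scale_weight \<alpha> j)) * (12 * (1 + \<bar>real_of_int k\<bar>) powr (-r))"
      proof (intro mult_right_mono mult_left_mono)
        define w where "w = 2 powr (of_int j / \<alpha>)"
        have "1 + of_int j / \<alpha> * ln 2 \<le> w"
          using exp_ge_add_one_self[of "of_int j / \<alpha> * ln 2"] by (simp add: powr_def w_def)
        moreover have "of_int j / \<alpha> * ln 2 \<ge> 0" using 3 \<alpha> by auto
        ultimately have "1 \<le> w" "of_int j / \<alpha> * ln 2 \<le> w" by auto
        moreover from this have "real_of_int j \<le> \<alpha> / ln 2 * w" using \<alpha> by (simp add: field_simps)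
        ultimately show "3 + \<bar>real_of_int j\<bar> \<le> K * scale_weight \<alpha> j"
          using 3(1) by (simp add: scale_weight_def w_def K_def algebra_simps)
      qed (use C0 in auto)
      finally have "(C0 * (3 + \<bar>real_of_int j\<bar>)) * ((3 + \<bar>real_of_int k\<bar>) powr \<rho> * qdecay x)
        \<le> (12 * C0 * K) * scale_weight \<alpha> j * (1 + \<bar>real_of_int k\<bar>) powr (-r)" by (simp add: mult_ac)
      moreover have "\<bar>e j k\<bar> * qdecay x \<le> (C0 * (3 + \<bar>real_of_int j\<bar>) * (3 + \<bar>real_of_int k\<bar>) powr \<rho>) * qdecay x"
        using e0'[of j k] q0 by (intro mult_right_mono) auto
      moreover have "(12 * C0 * K) * scale_weight \<alpha> j * (1 + \<bar>of_int k\<bar>) powr (-r)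
        \<le> C * scale_weight \<alpha> j * ((1 + \<bar>x\<bar>) powr (-r) + (1 + \<bar>of_int k\<bar>) powr (-r))"
        by (intro mult_mono C order_refl) (use s0 C in auto)
      ultimately show ?thesis by (simp add: mult_ac)
    qed
  qed
  show thesis by (rule that[OF C(1) r(1)]) (rule main[OF _ refl])
qed

section \<open>Increments of the field\<close>

lemma infsum_diff_real:
  fixes f g :: "'a \<Rightarrow> real"
  assumes "f summable_on A" "g summable_on A"
  shows "(\<Sum>\<^sub>\<infinity>x\<in>A. f x - g x) = infsum f A - infsum g A"
  using infsum_add[OF assms(1), of "\<lambda>x. - g x"] assms(2)
  by (simp add: infsum_uminus summable_on_uminus)

text \<open>Writing \<open>2^j h = y\<close> with y in the dyadic block \<open>j + \<lfloor>log 2 h\<rfloor>\<close>, the left side is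
  \<open>h^\<kappa>\<close> times \<open>y^(-\<kappa>) min 1 y\<close>, which decays geometrically in the block number.\<close>
lemma dyadic_scale_bound:
  fixes j :: int and \<kappa> \<delta> h :: real
  assumes \<delta>: "0 < \<delta>" and \<kappa>: "\<delta> \<le> \<kappa>" "\<kappa> \<le> 1 - \<delta>" and h: "h > 0"
  shows "2 powr (- of_int j * \<kappa>) * min 1 (2 powr of_int j * h)
    \<le> h powr \<kappa> * (2 * 2 powr (- \<delta> * \<bar>of_int (j + \<lfloor>log 2 h\<rfloor>)\<bar>))"
proof -
  define t where "t = log 2 h"
  define m where "m = j + \<lfloor>t\<rfloor>"
  have ht: "h = 2 powr t" using h by (simp add: t_def)
  have m: "real_of_int m \<le> of_int j + t" "of_int j + t \<le> of_int m + 1"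
    unfolding m_def of_int_add by linarith+
  \<comment> \<open>For m \<ge> 0 the minimum is replaced by 1 and the rate is \<kappa> \<ge>
    \<delta>; for m < 0 it is replaced by 2^j h and the rate is 1 - \<kappa> \<ge> \<delta>. The
    summand 1 in the exponent is slack for rounding log 2 h, used in the second case.\<close>
  have "2 powr (- of_int j * \<kappa>) * min 1 (2 powr of_int j * h) \<le> 2 powr (\<kappa> * t + (1 - \<delta> * \<bar>of_int m\<bar>))"
  proof (cases "m \<ge> 0")
    case True
    have "\<delta> * of_int m \<le> \<kappa> * of_int m" using \<kappa> True by (intro mult_right_mono) auto
    also have "\<dots> \<le> \<kappa> * (of_int j + t)" using m \<kappa> \<delta> by (intro mult_left_mono) auto
    finally have "\<delta> * of_int m \<le> \<kappa> * of_int j + \<kappa> * t" by (simp add: algebra_simps)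
    then have "- of_int j * \<kappa> \<le> \<kappa> * t + (1 - \<delta> * \<bar>of_int m\<bar>)"
      using True by (simp add: mult.commute)
    then have "2 powr (- of_int j * \<kappa>) \<le> 2 powr (\<kappa> * t + (1 - \<delta> * \<bar>of_int m\<bar>))" by simp
    moreover have "2 powr (- of_int j * \<kappa>) * min 1 (2 powr of_int j * h) \<le> 2 powr (- of_int j * \<kappa>) * 1"
      by (intro mult_left_mono) auto
    ultimately show ?thesis unfolding mult_1_right by linarith
  next
    case False
    then have m1: "real_of_int m + 1 \<le> 0" by linarith
    have "(1 - \<kappa>) * (of_int j + t) \<le> (1 - \<kappa>) * (of_int m + 1)"
      using m \<kappa> \<delta> by (intro mult_left_mono) auto
    also have "\<dots> \<le> \<delta> * (of_int m + 1)" using \<kappa> m1 by (intro mult_right_mono_neg) auto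
    finally have "of_int j + t - \<kappa> * of_int j - \<kappa> * t \<le> \<delta> * of_int m + \<delta>"
      by (simp add: algebra_simps)
    moreover have "\<delta> \<le> 1" using \<kappa> by linarith
    moreover have "\<bar>real_of_int m\<bar> = - of_int m" using False by simp
    ultimately have "- of_int j * \<kappa> + (of_int j + t) \<le> \<kappa> * t + (1 - \<delta> * \<bar>of_int m\<bar>)"
      by (simp add: mult.commute)
    then have "2 powr (- of_int j * \<kappa> + (of_int j + t)) \<le> 2 powr (\<kappa> * t + (1 - \<delta> * \<bar>of_int m\<bar>))"
      by simp
    moreover have "2 powr (- of_int j * \<kappa>) * min 1 (2 powr of_int j * h)
        \<le> 2 powr (- of_int j * \<kappa>) * (2 powr of_int j * h)"
      by (intro mult_left_mono) auto
    moreover have "2 powr (- of_int j * \<kappa>) * (2 powr of_int j * h) = 2 powr (- of_int j * \<kappa> + (of_int j + t))"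
      unfolding ht by (simp only: powr_add)
    ultimately show ?thesis by linarith
  qed
  also have "2 powr (\<kappa> * t + (1 - \<delta> * \<bar>of_int m\<bar>)) = h powr \<kappa> * (2 * 2 powr (- \<delta> * \<bar>of_int m\<bar>))"
    unfolding ht by (simp add: powr_add[symmetric] powr_powr mult.commute powr_mult_base)
  finally show ?thesis by (simp add: m_def t_def)
qed

section \<open>Weights of the scales, uniformly in the exponent\<close>

text \<open>A majorant of 2^(-jv) that is free of v: the lower end of the exponent interval is the
  worst one for j \<ge> 0, the upper end for j < 0.\<close>

definition scale_factor :: "real \<Rightarrow> real \<Rightarrow> int \<Rightarrow> real" where
  "scale_factor \<alpha> \<delta> j = (if j \<ge> 0 then 2 powr (- of_int j * (1/\<alpha> + \<delta>)) else 2 powr (- of_int j * (1 - \<delta>)))"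

lemma scale_factor_ge:
  assumes "v \<in> {1/\<alpha> + \<delta>..1 - \<delta>}"
  shows "2 powr (- of_int j * v) \<le> scale_factor \<alpha> \<delta> j"
proof (cases "j \<ge> 0")
  case True
  then have "of_int j * (1/\<alpha> + \<delta>) \<le> of_int j * v" using assms by (intro mult_left_mono) auto
  then show ?thesis using True by (simp add: scale_factor_def)
next
  case False
  then have "of_int j * (1 - \<delta>) \<le> of_int j * v" using assms by (intro mult_left_mono_neg) auto
  then show ?thesis using False by (simp add: scale_factor_def)
qed

lemma scale_factor_Lipschitz:
  assumes "v \<in> {1/\<alpha> + \<delta>..1 - \<delta>}" "v' \<in> {1/\<alpha> + \<delta>..1 - \<delta>}"
  shows "\<bar>2 powr (- of_int j * v) - 2 powr (- of_int j * v')\<bar> \<le> \<bar>of_int j\<bar> * scale_factor \<alpha> \<delta> j * \<bar>v - v'\<bar>"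
proof -
  have "norm (2 powr (- of_int j * v) - 2 powr (- of_int j * v')) \<le> (\<bar>of_int j\<bar> * scale_factor \<alpha> \<delta> j) * norm (v - v')"
  proof (rule field_differentiable_bound[where S = "{1/\<alpha> + \<delta>..1 - \<delta>}"
        and f' = "\<lambda>z. 2 powr (- of_int j * z) * (- of_int j * ln 2)"])
    fix z assume z: "z \<in> {1/\<alpha> + \<delta>..1 - \<delta>}"
    have "((\<lambda>z. exp (- of_int j * z * ln 2)) has_real_derivative exp (- of_int j * z * ln 2) * (- of_int j * ln 2)) (at z)"
      by (auto intro!: derivative_eq_intros)
    then have "((\<lambda>z. 2 powr (- of_int j * z)) has_real_derivative 2 powr (- of_int j * z) * (- of_int j * ln 2)) (at z)"
      by (simp add: powr_def)
    then show "((\<lambda>z. 2 powr (- of_int j * z)) has_field_derivative 2 powr (- of_int j * z) * (- of_int j * ln 2))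
        (at z within {1/\<alpha> + \<delta>..1 - \<delta>})"
      by (rule has_field_derivative_at_within)
    have "norm (2 powr (- of_int j * z) * (- of_int j * ln 2)) = 2 powr (- of_int j * z) * (\<bar>of_int j\<bar> * ln 2)"
      by (simp add: abs_mult)
    also have "\<dots> \<le> scale_factor \<alpha> \<delta> j * (\<bar>of_int j\<bar> * 1)"
      using ln_2_less_1 by (intro mult_mono scale_factor_ge z mult_left_mono) (auto simp: scale_factor_def)
    finally show "norm (2 powr (- of_int j * z) * (- of_int j * ln 2)) \<le> \<bar>of_int j\<bar> * scale_factor \<alpha> \<delta> j"
      by (simp add: mult.commute)
  qed (use assms in auto)
  then show ?thesis by simp
qed

text \<open>The two margins \<open>\<delta>\<close> become exponential decay in |j| on both sides.
  At fine scales 1/\<alpha> cancels the coefficient growth; at coarse scales the factor 2^j is the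
  one supplied by an increment of \<open>Psi\<close>.\<close>

lemma scale_factor_weight:
  "j \<ge> 0 \<Longrightarrow> scale_factor \<alpha> \<delta> j * scale_weight \<alpha> j = 2 powr (- \<delta> * \<bar>of_int j\<bar>)"
  "j < 0 \<Longrightarrow> scale_factor \<alpha> \<delta> j * 2 powr of_int j * scale_weight \<alpha> j = (3 + \<bar>of_int j\<bar>) * 2 powr (- \<delta> * \<bar>of_int j\<bar>)"
  by (simp_all add: scale_factor_def scale_weight_def powr_add[symmetric] algebra_simps)

text \<open>At fine scales the weight 2^(j/\<alpha>) shifts v to v - 1/\<alpha> and
  \<open>dyadic_scale_bound\<close> applies. At coarse scales only a bound linear in h is available,
  and h = h^\<kappa> h^(1-\<kappa>) \<le> (2L + 1) h^\<kappa> on the bounded range.\<close>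

lemma Holder_in_space_weight:
  fixes j :: int
  assumes \<delta>: "0 < \<delta>" and \<alpha>: "1 < \<alpha>" and v: "v \<in> {1/\<alpha> + \<delta>..1 - \<delta>}" and h: "0 < h" "h \<le> 2 * L"
  shows "2 powr (- of_int j * v) * min 1 (2 powr of_int j * h) * scale_weight \<alpha> j
    \<le> h powr (v - 1/\<alpha>) * (2 * 2 powr (- \<delta> * \<bar>of_int (j + \<lfloor>log 2 h\<rfloor>)\<bar>)
        + (2 * L + 1) * ((3 + \<bar>of_int j\<bar>)^2 * 2 powr (- \<delta> * \<bar>of_int j\<bar>)))"
proof -
  define \<kappa> where "\<kappa> = v - 1/\<alpha>"
  define p where "p = 2 powr (- \<delta> * \<bar>real_of_int j\<bar>)"
  have a: "1/\<alpha> > 0" using \<alpha> by simp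
  have "v \<le> 1 - \<delta>" using v by simp
  then have "\<kappa> \<le> 1 - \<delta>" using a unfolding \<kappa>_def by linarith
  moreover have "\<delta> \<le> \<kappa>" using v by (simp add: \<kappa>_def)
  ultimately have \<kappa>: "\<delta> \<le> \<kappa>" "\<kappa> \<le> 1 - \<delta>" by auto
  have p0: "p \<ge> 0" by (simp add: p_def)
  show ?thesis
  proof (cases "j \<ge> 0")
    case True
    have "2 powr (- of_int j * v) * scale_weight \<alpha> j = 2 powr (- of_int j * \<kappa>)"
      using True by (simp add: scale_weight_def \<kappa>_def powr_add[symmetric] algebra_simps)
    then have "2 powr (- of_int j * v) * min 1 (2 powr of_int j * h) * scale_weight \<alpha> j
        = 2 powr (- of_int j * \<kappa>) * min 1 (2 powr of_int j * h)" by (metis mult.assoc mult.commute)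
    also have "\<dots> \<le> h powr \<kappa> * (2 * 2 powr (- \<delta> * \<bar>of_int (j + \<lfloor>log 2 h\<rfloor>)\<bar>))"
      by (rule dyadic_scale_bound[OF \<delta> \<kappa> h(1)])
    also have "\<dots> \<le> h powr \<kappa> * (2 * 2 powr (- \<delta> * \<bar>of_int (j + \<lfloor>log 2 h\<rfloor>)\<bar>)
        + (2 * L + 1) * ((3 + \<bar>of_int j\<bar>)^2 * p))"
      using h p0 by (intro mult_left_mono) auto
    finally show ?thesis by (simp add: \<kappa>_def p_def)
  next
    case False
    have "h powr (1 - \<kappa>) \<le> max 1 h" by (rule powr_le_max) (use \<kappa> \<delta> h in auto)
    also have "\<dots> \<le> 2 * L + 1" using h by auto
    finally have "h powr \<kappa> * h powr (1 - \<kappa>) \<le> h powr \<kappa> * (2 * L + 1)" by (intro mult_left_mono) auto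
    then have hk: "h \<le> h powr \<kappa> * (2 * L + 1)" using h by (simp add: powr_add[symmetric])
    have "3 + \<bar>real_of_int j\<bar> \<le> (3 + \<bar>real_of_int j\<bar>)^2"
      by (rule self_le_power) auto
    then have p2: "(3 + \<bar>of_int j\<bar>) * p \<le> (3 + \<bar>of_int j\<bar>)^2 * p" using p0 by (intro mult_right_mono)
    note w0 = less_imp_le[OF scale_weight_pos, of \<alpha> j]
    have "2 powr (- of_int j * v) * min 1 (2 powr of_int j * h) * scale_weight \<alpha> j
        \<le> scale_factor \<alpha> \<delta> j * (2 powr of_int j * h) * scale_weight \<alpha> j"
      by (intro mult_right_mono mult_mono scale_factor_ge v w0) (use h in \<open>auto simp: scale_factor_def\<close>)
    also have "\<dots> = h * (scale_factor \<alpha> \<delta> j * 2 powr of_int j * scale_weight \<alpha> j)"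
      by (simp only: mult_ac)
    also have "\<dots> = h * ((3 + \<bar>of_int j\<bar>) * p)"
      using False by (simp add: scale_factor_weight p_def)
    also have "\<dots> \<le> (h powr \<kappa> * (2 * L + 1)) * ((3 + \<bar>of_int j\<bar>)^2 * p)"
      by (intro mult_mono hk p2) (use h p0 in auto)
    also have "\<dots> \<le> h powr \<kappa> * (2 * 2 powr (- \<delta> * \<bar>of_int (j + \<lfloor>log 2 h\<rfloor>)\<bar>)
        + (2 * L + 1) * ((3 + \<bar>of_int j\<bar>)^2 * p))"
      unfolding mult.assoc by (intro mult_left_mono) auto
    finally show ?thesis by (simp add: \<kappa>_def p_def)
  qed
qed

text \<open>In 1 + |j| the 1 comes from varying v inside \<open>Psi\<close>, the |j| from varying it
  in 2^(-jv). The displacement is measured from 0, the reference point of the series, and its factor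
  2^j is spent at coarse scales only.\<close>

lemma Lipschitz_in_exponent_weight:
  fixes j :: int
  assumes u: "\<bar>u\<bar> \<le> L"
  shows "(1 + \<bar>of_int j\<bar>) * scale_factor \<alpha> \<delta> j * min 1 (2 powr of_int j * \<bar>u\<bar>) * scale_weight \<alpha> j
    \<le> (1 + L) * ((3 + \<bar>of_int j\<bar>)^2 * 2 powr (- \<delta> * \<bar>of_int j\<bar>))"
proof -
  define p where "p = 2 powr (- \<delta> * \<bar>real_of_int j\<bar>)"
  have p0: "p \<ge> 0" by (simp add: p_def)
  have L: "L \<ge> 0" using u by linarith
  have f0: "scale_factor \<alpha> \<delta> j \<ge> 0" by (simp add: scale_factor_def)
  note w0 = less_imp_le[OF scale_weight_pos, of \<alpha> j]
  have q: "scale_factor \<alpha> \<delta> j * min 1 (2 powr of_int j * \<bar>u\<bar>) * scale_weight \<alpha> j \<le> (1 + L) * ((3 + \<bar>of_int j\<bar>) * p)"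
  proof (cases "j \<ge> 0")
    case True
    have "scale_factor \<alpha> \<delta> j * min 1 (2 powr of_int j * \<bar>u\<bar>) * scale_weight \<alpha> j \<le> scale_factor \<alpha> \<delta> j * 1 * scale_weight \<alpha> j"
      by (intro mult_right_mono mult_left_mono w0 f0) auto
    also have "\<dots> = 1 * (1 * p)" using True by (simp add: scale_factor_weight p_def)
    also have "\<dots> \<le> (1 + L) * ((3 + \<bar>of_int j\<bar>) * p)"
      by (intro mult_mono) (use L p0 in auto)
    finally show ?thesis .
  next
    case False
    have "scale_factor \<alpha> \<delta> j * min 1 (2 powr of_int j * \<bar>u\<bar>) * scale_weight \<alpha> j
        \<le> scale_factor \<alpha> \<delta> j * (2 powr of_int j * L) * scale_weight \<alpha> j"
      by (intro mult_right_mono mult_left_mono w0 f0 min.coboundedI2) (use u in auto)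
    also have "\<dots> = L * (scale_factor \<alpha> \<delta> j * 2 powr of_int j * scale_weight \<alpha> j)"
      by (simp only: mult_ac)
    also have "\<dots> = L * ((3 + \<bar>of_int j\<bar>) * p)"
      using False by (simp add: scale_factor_weight p_def)
    also have "\<dots> \<le> (1 + L) * ((3 + \<bar>of_int j\<bar>) * p)"
      by (intro mult_right_mono) (use p0 in auto)
    finally show ?thesis .
  qed
  have "(1 + \<bar>of_int j\<bar>) * (scale_factor \<alpha> \<delta> j * min 1 (2 powr of_int j * \<bar>u\<bar>) * scale_weight \<alpha> j)
      \<le> (3 + \<bar>of_int j\<bar>) * ((1 + L) * ((3 + \<bar>of_int j\<bar>) * p))"
    by (intro mult_mono q) (use f0 w0 in auto)
  then show ?thesis by (simp add: p_def power2_eq_square mult_ac)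
qed

definition field_term :: "(real \<Rightarrow> real) \<Rightarrow> real \<Rightarrow> (int \<Rightarrow> int \<Rightarrow> real) \<Rightarrow> real \<Rightarrow> real \<Rightarrow> int \<times> int \<Rightarrow> real" where
  "field_term \<psi> \<alpha> e u v = (\<lambda>(j, k). 2 powr (- real_of_int j * v) * e j k *
      (Psi \<psi> \<alpha> (2 powr real_of_int j * u - real_of_int k) v - Psi \<psi> \<alpha> (- real_of_int k) v))"

lemma Xfield_eq_infsum: "Xfield \<psi> \<alpha> e u v = infsum (field_term \<psi> \<alpha> e u v) UNIV"
  by (simp add: Xfield_def field_term_def)

lemma Xfield_increments:
  assumes \<alpha>: "1 < \<alpha>" and w: "smooth_cs_wavelet \<psi>" and O0: "Omega0_prop \<alpha> e" and O1: "Omega1_prop \<alpha> e"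
    and \<delta>: "\<delta> > 0" and L: "L \<ge> 0"
  obtains B where "B \<ge> 0"
    "\<And>u u' v. \<bar>u\<bar> \<le> L \<Longrightarrow> \<bar>u'\<bar> \<le> L \<Longrightarrow> u \<noteq> u' \<Longrightarrow> v \<in> {1/\<alpha> + \<delta>..1 - \<delta>} \<Longrightarrow>
       \<bar>Xfield \<psi> \<alpha> e u v - Xfield \<psi> \<alpha> e u' v\<bar> \<le> B * \<bar>u - u'\<bar> powr (v - 1/\<alpha>)"
    "\<And>u v v'. \<bar>u\<bar> \<le> L \<Longrightarrow> v \<in> {1/\<alpha> + \<delta>..1 - \<delta>} \<Longrightarrow> v' \<in> {1/\<alpha> + \<delta>..1 - \<delta>} \<Longrightarrow>
       \<bar>Xfield \<psi> \<alpha> e u v - Xfield \<psi> \<alpha> e u v'\<bar> \<le> B * \<bar>v - v'\<bar>"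
proof -
  obtain CP where CP: "CP > 0" and
    P1: "\<And>v x y. v - 1/\<alpha> \<in> {\<delta>..1-\<delta>} \<Longrightarrow>
       \<bar>Psi \<psi> \<alpha> x v - Psi \<psi> \<alpha> y v\<bar> \<le> CP * min 1 \<bar>x - y\<bar> * (qdecay x + qdecay y)" and
    P2: "\<And>v v' x y. v - 1/\<alpha> \<in> {\<delta>..1-\<delta>} \<Longrightarrow> v' - 1/\<alpha> \<in> {\<delta>..1-\<delta>} \<Longrightarrow>
       \<bar>(Psi \<psi> \<alpha> x v - Psi \<psi> \<alpha> x v') - (Psi \<psi> \<alpha> y v - Psi \<psi> \<alpha> y v')\<bar>
         \<le> CP * \<bar>v - v'\<bar> * min 1 \<bar>x - y\<bar> * (qdecay x + qdecay y)"
    by (rule Psi_increment_bounds[OF w \<delta>]) (rule that)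
  obtain C r where C: "C > 0" and r: "r > 1" and
    cd: "\<And>j k u. \<bar>u\<bar> \<le> L \<Longrightarrow> \<bar>e j k\<bar> * qdecay (2 powr of_int j * u - of_int k)
      \<le> C * scale_weight \<alpha> j * ((1 + \<bar>2 powr of_int j * u - of_int k\<bar>) powr (-r) + (1 + \<bar>of_int k\<bar>) powr (-r))"
    by (rule coefficient_decay[OF \<alpha> O0 O1 L]) (rule that)
  from uniform_lattice_sum[OF r] obtain Q where Q: "Q > 0"
    and Qs: "\<And>x. (\<lambda>k::int. (1 + \<bar>x - of_int k\<bar>) powr (-r)) summable_on UNIV"
    and Qb: "\<And>x. (\<Sum>\<^sub>\<infinity>k::int. (1 + \<bar>x - of_int k\<bar>) powr (-r)) \<le> Q"
    by blast
  define a where "a = scale_weight \<alpha>"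
  have a0: "a j \<ge> 0" for j using scale_weight_pos[of \<alpha> j] by (simp add: a_def)
  have inv: "v - 1/\<alpha> \<in> {\<delta>..1-\<delta>}" if "v \<in> {1/\<alpha> + \<delta>..1 - \<delta>}" for v
    using that \<alpha> by (auto intro: order_trans[of _ "v"])
  define p where "p x k = (1 + \<bar>x - of_int k\<bar>) powr (-r)" for x and k :: int
  \<comment> \<open>\<open>coefficient_decay\<close> gives a bump around each of the two points and
    one more around 0 each time; hence four bumps in all and the bound 4 Q.\<close>
  define P where "P u u' j k = p (2 powr of_int j * u) k + p (2 powr of_int j * u') k + 2 * p 0 k" for u u' and j k :: int
  have p0: "p x k \<ge> 0" for x k by (simp add: p_def)
  have P0: "P u u' j k \<ge> 0" for u u' j k using p0 by (simp add: P_def)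
  have ps: "p x summable_on UNIV" "infsum (p x) UNIV \<le> Q" for x
    using Qs Qb by (auto simp: p_def[abs_def])
  have Ps: "P u u' j summable_on UNIV" for u u' j
    unfolding P_def by (intro summable_on_add summable_on_cmult_right ps)
  have Pb: "infsum (P u u' j) UNIV \<le> 4 * Q" for u u' j
  proof -
    have "infsum (P u u' j) UNIV = infsum (p (2 powr of_int j * u)) UNIV
        + infsum (p (2 powr of_int j * u')) UNIV + 2 * infsum (p 0) UNIV"
      unfolding P_def by (subst infsum_add infsum_cmult_right' | intro summable_on_add summable_on_cmult_right ps refl)+
    also have "\<dots> \<le> Q + Q + 2 * Q" by (intro add_mono mult_left_mono ps) auto
    finally show ?thesis by simp
  qed
  have eq: "\<bar>e j k\<bar> * (qdecay (2 powr of_int j * u - of_int k) + qdecay (2 powr of_int j * u' - of_int k)) \<le> C * a j * P u u' j k"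
    if "\<bar>u\<bar> \<le> L" "\<bar>u'\<bar> \<le> L" for u u' j k
    using cd[OF that(1), of j k] cd[OF that(2), of j k] by (simp add: P_def p_def a_def algebra_simps)
  define s where "s j = 2 powr (- \<delta> * \<bar>real_of_int j\<bar>)" for j :: int
  define s2 where "s2 j = (3 + \<bar>real_of_int j\<bar>)^2 * 2 powr (- \<delta> * \<bar>real_of_int j\<bar>)" for j :: int
  have s2s: "s2 summable_on UNIV"
    using summable_quadratic_exponential[OF \<delta>] by (simp add: s2_def[abs_def])
  have ss: "s summable_on UNIV"
  proof (rule summable_on_comparison_test[OF s2s])
    fix j
    have "1 * s j \<le> (3 + \<bar>real_of_int j\<bar>)^2 * s j"
      by (intro mult_right_mono one_le_power) (auto simp: s_def)
    then show "s j \<le> s2 j" by (simp add: s_def s2_def)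
  qed (auto simp: s_def)
  have S0: "infsum s UNIV \<ge> 0" "infsum s2 UNIV \<ge> 0"
    by (auto intro!: infsum_nonneg simp: s_def s2_def)
  let ?T = "field_term \<psi> \<alpha> e"
  define B1 where "B1 = 4 * Q * (CP * C * (2 * infsum s UNIV + (2 * L + 1) * infsum s2 UNIV))"
  define B2 where "B2 = 4 * Q * (CP * C * ((1 + L) * infsum s2 UNIV))"
  have B0: "B1 \<ge> 0" "B2 \<ge> 0" using Q CP C S0 L by (auto simp: B1_def B2_def)
  have space: "(\<lambda>x. ?T u v x - ?T u' v x) summable_on UNIV \<and>
      \<bar>\<Sum>\<^sub>\<infinity>x. ?T u v x - ?T u' v x\<bar> \<le> B1 * \<bar>u - u'\<bar> powr (v - 1/\<alpha>)"
    if u: "\<bar>u\<bar> \<le> L" "\<bar>u'\<bar> \<le> L" "u \<noteq> u'" and v: "v \<in> {1/\<alpha> + \<delta>..1 - \<delta>}" for u u' v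
  proof -
    define h where "h = \<bar>u - u'\<bar>"
    have h: "h > 0" "h \<le> 2 * L" using u by (auto simp: h_def)
    \<comment> \<open>The dependence of the scale sum on h, apart from the power, is a shift of the
      index by \<open>N\<close>. A sum over all integers is invariant under it, so no logarithm of h
      appears.\<close>
    define N where "N = \<lfloor>log 2 h\<rfloor>"
    define A where "A j = CP * C * (h powr (v - 1/\<alpha>) * (2 * s (j + N) + (2 * L + 1) * s2 j))" for j
    have bij: "bij_betw (\<lambda>j. j + N) UNIV UNIV"
      by (rule bij_betwI[where g = "\<lambda>j. j - N"]) auto
    have sN: "(\<lambda>j. s (j + N)) summable_on UNIV" "(\<Sum>\<^sub>\<infinity>j. s (j + N)) = infsum s UNIV"
      using summable_on_reindex_bij_betw[OF bij, of s] infsum_reindex_bij_betw[OF bij, of s] ss by auto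
    have As: "A summable_on UNIV"
      unfolding A_def by (intro summable_on_add summable_on_cmult_right sN s2s)
    have "infsum A UNIV = CP * C * (h powr (v - 1/\<alpha>) * (\<Sum>\<^sub>\<infinity>j. 2 * s (j + N) + (2 * L + 1) * s2 j))"
      unfolding A_def by (simp add: infsum_cmult_right')
    also have "(\<Sum>\<^sub>\<infinity>j. 2 * s (j + N) + (2 * L + 1) * s2 j) = 2 * infsum s UNIV + (2 * L + 1) * infsum s2 UNIV"
      by (subst infsum_add) (auto intro!: summable_on_cmult_right sN s2s simp: infsum_cmult_right' sN)
    finally have AI: "4 * Q * infsum A UNIV = B1 * h powr (v - 1/\<alpha>)" by (simp add: B1_def mult_ac)
    have A0: "A j \<ge> 0" for j using CP C L by (auto simp: A_def s_def s2_def)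
    have bound: "\<bar>?T u v (j, k) - ?T u' v (j, k)\<bar> \<le> A j * P u u' j k" for j k
    proof -
      let ?x = "2 powr of_int j * u - of_int k" and ?y = "2 powr of_int j * u' - of_int k"
      let ?m = "min 1 (2 powr of_int j * h)"
      have m0: "?m \<ge> 0" using h by simp
      have xy: "\<bar>?x - ?y\<bar> = 2 powr of_int j * h"
      proof -
        have "?x - ?y = 2 powr of_int j * (u - u')" by (simp add: algebra_simps)
        then show ?thesis by (simp only: h_def abs_mult) simp
      qed
      have "?T u v (j, k) - ?T u' v (j, k) = 2 powr (- of_int j * v) * e j k * (Psi \<psi> \<alpha> ?x v - Psi \<psi> \<alpha> ?y v)"
        by (simp add: field_term_def algebra_simps)
      then have "\<bar>?T u v (j, k) - ?T u' v (j, k)\<bar> = 2 powr (- of_int j * v) * \<bar>e j k\<bar> * \<bar>Psi \<psi> \<alpha> ?x v - Psi \<psi> \<alpha> ?y v\<bar>"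
        by (simp add: abs_mult)
      also have "\<dots> \<le> 2 powr (- of_int j * v) * \<bar>e j k\<bar> * (CP * ?m * (qdecay ?x + qdecay ?y))"
        using P1[OF inv[OF v], of ?x ?y] unfolding xy by (intro mult_left_mono) auto
      also have "\<dots> = (CP * 2 powr (- of_int j * v) * ?m) * (\<bar>e j k\<bar> * (qdecay ?x + qdecay ?y))"
        by (simp only: mult_ac)
      also have "\<dots> \<le> (CP * 2 powr (- of_int j * v) * ?m) * (C * a j * P u u' j k)"
        by (intro mult_left_mono eq u) (use CP m0 in auto)
      also have "\<dots> = (CP * C * P u u' j k) * (2 powr (- of_int j * v) * ?m * a j)"
        by (simp only: mult_ac)
      also have "\<dots> \<le> (CP * C * P u u' j k) * (h powr (v - 1/\<alpha>) * (2 * s (j + N) + (2 * L + 1) * s2 j))"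
        unfolding a_def s_def s2_def N_def
        by (intro mult_left_mono Holder_in_space_weight \<delta> \<alpha> v h) (use CP C P0 in auto)
      also have "\<dots> = A j * P u u' j k" unfolding A_def by (simp only: mult_ac)
      finally show ?thesis .
    qed
    from double_sum_bound[OF bound A0 As P0 Ps Pb] show ?thesis unfolding AI h_def by blast
  qed
  \<comment> \<open>Since the terms vanish at u = 0, the increment bound with u' = 0 yields
    summability of the series for the field itself; u = 0 is separate because \<open>space\<close>
    requires distinct points.\<close>
  have T0: "?T 0 v = (\<lambda>_. 0)" for v by (auto simp: field_term_def)
  have Ts: "?T u v summable_on UNIV" if "\<bar>u\<bar> \<le> L" "v \<in> {1/\<alpha> + \<delta>..1 - \<delta>}" for u v
    using space[of u 0 v] that L T0 by (cases "u = 0") auto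
  have expo: "\<bar>\<Sum>\<^sub>\<infinity>x. ?T u v x - ?T u v' x\<bar> \<le> B2 * \<bar>v - v'\<bar>"
    if u: "\<bar>u\<bar> \<le> L" and v: "v \<in> {1/\<alpha> + \<delta>..1 - \<delta>}" "v' \<in> {1/\<alpha> + \<delta>..1 - \<delta>}" for u v v'
  proof -
    define A where "A j = CP * C * \<bar>v - v'\<bar> * ((1 + L) * s2 j)" for j
    have As: "A summable_on UNIV"
      unfolding A_def by (intro summable_on_cmult_right s2s)
    have "infsum A UNIV = CP * C * \<bar>v - v'\<bar> * ((1 + L) * infsum s2 UNIV)"
      unfolding A_def by (simp add: infsum_cmult_right')
    then have AI: "4 * Q * infsum A UNIV = B2 * \<bar>v - v'\<bar>" by (simp add: B2_def mult_ac)
    have A0: "A j \<ge> 0" for j using CP C L by (auto simp: A_def s2_def)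
    have bound: "\<bar>?T u v (j, k) - ?T u v' (j, k)\<bar> \<le> A j * P u 0 j k" for j k
    proof -
      \<comment> \<open>The reference point -k is written as 2^j * 0 - k, so that the estimates for
        two points apply with u' = 0.\<close>
      let ?x = "2 powr of_int j * u - of_int k" and ?y = "2 powr of_int j * 0 - of_int k"
      let ?m = "min 1 (2 powr of_int j * \<bar>u\<bar>)"
      let ?q = "qdecay ?x + qdecay ?y"
      define D where "D v = Psi \<psi> \<alpha> ?x v - Psi \<psi> \<alpha> ?y v" for v
      have m0: "?m \<ge> 0" by simp
      have q0: "?q \<ge> 0" using qdecay_pos less_imp_le by (simp add: add_nonneg_nonneg less_imp_le)
      have xy: "\<bar>?x - ?y\<bar> = 2 powr of_int j * \<bar>u\<bar>" by (simp add: abs_mult)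
      have f0: "scale_factor \<alpha> \<delta> j \<ge> 0" by (simp add: scale_factor_def)
      have D1: "\<bar>D v'\<bar> \<le> CP * ?m * ?q"
        using P1[OF inv[OF v(2)], of ?x ?y] unfolding xy D_def .
      have "D v - D v' = (Psi \<psi> \<alpha> ?x v - Psi \<psi> \<alpha> ?x v') - (Psi \<psi> \<alpha> ?y v - Psi \<psi> \<alpha> ?y v')"
        by (simp add: D_def)
      then have D2: "\<bar>D v - D v'\<bar> \<le> CP * \<bar>v - v'\<bar> * ?m * ?q"
        using P2[OF inv[OF v(1)] inv[OF v(2)], of ?x ?y] unfolding xy by simp
      have "?T u v (j, k) - ?T u v' (j, k) = e j k * (2 powr (- of_int j * v) * (D v - D v')
          + (2 powr (- of_int j * v) - 2 powr (- of_int j * v')) * D v')"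
        by (simp add: field_term_def D_def algebra_simps)
      then have "\<bar>?T u v (j, k) - ?T u v' (j, k)\<bar> \<le> \<bar>e j k\<bar> * (2 powr (- of_int j * v) * \<bar>D v - D v'\<bar>
          + \<bar>2 powr (- of_int j * v) - 2 powr (- of_int j * v')\<bar> * \<bar>D v'\<bar>)"
        using abs_triangle_ineq[of "2 powr (- of_int j * v) * (D v - D v')" "(2 powr (- of_int j * v) - 2 powr (- of_int j * v')) * D v'"]
        by (simp only: abs_mult) (intro mult_left_mono; simp)
      also have "\<dots> \<le> \<bar>e j k\<bar> * (scale_factor \<alpha> \<delta> j * (CP * \<bar>v - v'\<bar> * ?m * ?q)
          + (\<bar>of_int j\<bar> * scale_factor \<alpha> \<delta> j * \<bar>v - v'\<bar>) * (CP * ?m * ?q))"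
        by (intro mult_left_mono add_mono mult_mono D1 D2 scale_factor_ge scale_factor_Lipschitz v)
           (use f0 in auto)
      also have "\<dots> = (CP * \<bar>v - v'\<bar> * ((1 + \<bar>of_int j\<bar>) * scale_factor \<alpha> \<delta> j * ?m)) * (\<bar>e j k\<bar> * ?q)"
        by (simp only: distrib_left distrib_right mult_ac mult_1_left)
      also have "\<dots> \<le> (CP * \<bar>v - v'\<bar> * ((1 + \<bar>of_int j\<bar>) * scale_factor \<alpha> \<delta> j * ?m)) * (C * a j * P u 0 j k)"
        by (intro mult_left_mono eq u) (use CP m0 L f0 in auto)
      also have "\<dots> = (CP * C * \<bar>v - v'\<bar> * P u 0 j k) * ((1 + \<bar>of_int j\<bar>) * scale_factor \<alpha> \<delta> j * ?m * a j)"
        by (simp only: mult_ac)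
      also have "\<dots> \<le> (CP * C * \<bar>v - v'\<bar> * P u 0 j k) * ((1 + L) * s2 j)"
        unfolding a_def s2_def
        by (intro mult_left_mono Lipschitz_in_exponent_weight u) (use CP C P0 in auto)
      also have "\<dots> = A j * P u 0 j k" unfolding A_def by (simp only: mult_ac)
      finally show ?thesis .
    qed
    from double_sum_bound(2)[OF bound A0 As P0 Ps Pb] show ?thesis unfolding AI .
  qed
  show thesis
  proof (rule that[of "B1 + B2"])
    show "B1 + B2 \<ge> 0" using B0 by simp
    fix u u' v assume u: "\<bar>u\<bar> \<le> L" "\<bar>u'\<bar> \<le> L" "u \<noteq> u'" and v: "v \<in> {1/\<alpha> + \<delta>..1 - \<delta>}"
    have "Xfield \<psi> \<alpha> e u v - Xfield \<psi> \<alpha> e u' v = (\<Sum>\<^sub>\<infinity>x. ?T u v x - ?T u' v x)"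
      unfolding Xfield_eq_infsum by (rule infsum_diff_real[symmetric]) (intro Ts u v)+
    then have "\<bar>Xfield \<psi> \<alpha> e u v - Xfield \<psi> \<alpha> e u' v\<bar> \<le> B1 * \<bar>u - u'\<bar> powr (v - 1/\<alpha>)"
      using space[OF u v] by simp
    also have "\<dots> \<le> (B1 + B2) * \<bar>u - u'\<bar> powr (v - 1/\<alpha>)"
      by (intro mult_right_mono) (use B0 in auto)
    finally show "\<bar>Xfield \<psi> \<alpha> e u v - Xfield \<psi> \<alpha> e u' v\<bar> \<le> (B1 + B2) * \<bar>u - u'\<bar> powr (v - 1/\<alpha>)" .
  next
    fix u v v' assume u: "\<bar>u\<bar> \<le> L" and v: "v \<in> {1/\<alpha> + \<delta>..1 - \<delta>}" "v' \<in> {1/\<alpha> + \<delta>..1 - \<delta>}"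
    have "Xfield \<psi> \<alpha> e u v - Xfield \<psi> \<alpha> e u v' = (\<Sum>\<^sub>\<infinity>x. ?T u v x - ?T u v' x)"
      unfolding Xfield_eq_infsum by (rule infsum_diff_real[symmetric]) (intro Ts u v)+
    then have "\<bar>Xfield \<psi> \<alpha> e u v - Xfield \<psi> \<alpha> e u v'\<bar> \<le> B2 * \<bar>v - v'\<bar>"
      using expo[OF u v] by simp
    also have "\<dots> \<le> (B1 + B2) * \<bar>v - v'\<bar>"
      by (intro mult_right_mono) (use B0 in auto)
    finally show "\<bar>Xfield \<psi> \<alpha> e u v - Xfield \<psi> \<alpha> e u v'\<bar> \<le> (B1 + B2) * \<bar>v - v'\<bar>" .
  qed
qed

section \<open>Composition with the Hurst function\<close>

theorem mainTheorem1:
  fixes \<alpha> :: real and \<psi> :: "real \<Rightarrow> real" and H :: "real \<Rightarrow> real"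
    and e :: "int \<Rightarrow> int \<Rightarrow> real" and a b \<gamma>H :: real
  assumes "1 < \<alpha>" and "\<alpha> < 2"
    and "smooth_cs_wavelet \<psi>"
    and "continuous_on UNIV H" and "\<forall>x. 1 / \<alpha> < H x \<and> H x < 1"
    and "a \<le> b"
    and "H ` {a..b} \<subseteq> {1 / \<alpha> <..< 1}"
    and "0 \<le> \<gamma>H" and "\<gamma>H < 1" and "holder_on \<gamma>H {a..b} H"
    and "Omega0_prop \<alpha> e" and "Omega1_prop \<alpha> e"
  shows "\<exists>C. \<forall>t\<in>{a..b}. \<forall>s\<in>{a..b}. t \<noteq> s \<longrightarrow>
           \<bar>LMSM \<psi> \<alpha> e H t - LMSM \<psi> \<alpha> e H s\<bar>
             \<le> C * \<bar>t - s\<bar> powr (min \<gamma>H (Inf (H ` {a..b}) - 1 / \<alpha>))"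
proof -
  have cH: "continuous_on {a..b} H" using assms(4) by (rule continuous_on_subset) simp
  obtain x0 where x0: "x0 \<in> {a..b}" "\<And>x. x \<in> {a..b} \<Longrightarrow> H x0 \<le> H x"
    using continuous_attains_inf[OF _ _ cH] assms(6) by auto
  obtain x1 where x1: "x1 \<in> {a..b}" "\<And>x. x \<in> {a..b} \<Longrightarrow> H x \<le> H x1"
    using continuous_attains_sup[OF _ _ cH] assms(6) by auto
  have inf: "Inf (H ` {a..b}) = H x0"
    by (rule cInf_eq_minimum) (use x0 in auto)
  \<comment> \<open>The extrema of H on the compact interval are attained inside (1/\<alpha>, 1), so
    the margin to both ends is positive.\<close>
  define \<delta> where "\<delta> = min (H x0 - 1/\<alpha>) (1 - H x1)"
  have \<delta>: "\<delta> > 0" using assms(5) by (simp add: \<delta>_def)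
  have Hv: "H x \<in> {1/\<alpha> + \<delta>..1 - \<delta>}" if "x \<in> {a..b}" for x
    using x0(2)[OF that] x1(2)[OF that] by (auto simp: \<delta>_def min_def split: if_splits)
  define \<mu> where "\<mu> = min \<gamma>H (H x0 - 1/\<alpha>)"
  have \<mu>0: "\<mu> \<ge> 0" using assms(5,8) by (auto simp: \<mu>_def less_imp_le)
  define L where "L = max \<bar>a\<bar> \<bar>b\<bar>"
  have L0: "L \<ge> 0" by (simp add: L_def)
  have inL: "\<bar>x\<bar> \<le> L" if "x \<in> {a..b}" for x using that by (auto simp: L_def)
  obtain B where B: "B \<ge> 0" and
    B1: "\<And>u u' v. \<bar>u\<bar> \<le> L \<Longrightarrow> \<bar>u'\<bar> \<le> L \<Longrightarrow> u \<noteq> u' \<Longrightarrow> v \<in> {1/\<alpha> + \<delta>..1 - \<delta>} \<Longrightarrow>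
       \<bar>Xfield \<psi> \<alpha> e u v - Xfield \<psi> \<alpha> e u' v\<bar> \<le> B * \<bar>u - u'\<bar> powr (v - 1/\<alpha>)" and
    B2: "\<And>u v v'. \<bar>u\<bar> \<le> L \<Longrightarrow> v \<in> {1/\<alpha> + \<delta>..1 - \<delta>} \<Longrightarrow> v' \<in> {1/\<alpha> + \<delta>..1 - \<delta>} \<Longrightarrow>
       \<bar>Xfield \<psi> \<alpha> e u v - Xfield \<psi> \<alpha> e u v'\<bar> \<le> B * \<bar>v - v'\<bar>"
    by (rule Xfield_increments[OF assms(1,3,11,12) \<delta> L0]) (rule that)
  from assms(10) obtain K where K: "\<And>x y. x \<in> {a..b} \<Longrightarrow> y \<in> {a..b} \<Longrightarrow> x \<noteq> y \<Longrightarrow> \<bar>H x - H y\<bar> \<le> K * \<bar>x - y\<bar> powr \<gamma>H"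
    unfolding holder_on_def by blast
  define M where "M = 1 + (b - a)"
  have M: "M \<ge> 1" using assms(6) by (simp add: M_def)
  \<comment> \<open>Lowering an exponent increases the power only for distances up to 1;
    \<open>M\<close> covers the longer ones.\<close>
  have pow: "h powr \<nu> \<le> M * h powr \<mu>" if h: "0 < h" "h \<le> M" and \<nu>: "\<mu> \<le> \<nu>" "\<nu> \<le> 1" for h \<nu>
  proof -
    have "h powr (\<nu> - \<mu>) \<le> max 1 h" by (rule powr_le_max) (use \<nu> \<mu>0 h in auto)
    also have "\<dots> \<le> M" using h M by auto
    finally have "h powr (\<nu> - \<mu>) * h powr \<mu> \<le> M * h powr \<mu>" by (intro mult_right_mono) auto
    then show ?thesis by (simp add: powr_add[symmetric])
  qed
  have "\<bar>LMSM \<psi> \<alpha> e H t - LMSM \<psi> \<alpha> e H s\<bar> \<le> (B * M + B * \<bar>K\<bar> * M) * \<bar>t - s\<bar> powr \<mu>"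
    if t: "t \<in> {a..b}" and s: "s \<in> {a..b}" and ts: "t \<noteq> s" for t s
  proof -
    have h: "0 < \<bar>t - s\<bar>" "\<bar>t - s\<bar> \<le> M" using t s ts by (auto simp: M_def)
    \<comment> \<open>The pivot is X(s, H(t)): space moves first with the exponent frozen at H(t),
      whose order H(t) - 1/\<alpha> is at least \<open>\<mu>\<close>; then the exponent moves at the
      fixed point s.\<close>
    have "\<bar>Xfield \<psi> \<alpha> e t (H t) - Xfield \<psi> \<alpha> e s (H t)\<bar> \<le> B * \<bar>t - s\<bar> powr (H t - 1/\<alpha>)"
      by (rule B1) (use t s ts inL Hv in auto)
    also have "\<dots> \<le> B * (M * \<bar>t - s\<bar> powr \<mu>)"
    proof (intro mult_left_mono pow h B)
      show "\<mu> \<le> H t - 1/\<alpha>" using x0(2)[OF t] by (auto simp: \<mu>_def)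
      have "1/\<alpha> > 0" using assms(1) by simp
      then show "H t - 1/\<alpha> \<le> 1" using assms(5)[rule_format, of t] by linarith
    qed
    finally have 1: "\<bar>Xfield \<psi> \<alpha> e t (H t) - Xfield \<psi> \<alpha> e s (H t)\<bar> \<le> B * (M * \<bar>t - s\<bar> powr \<mu>)" .
    have "\<bar>Xfield \<psi> \<alpha> e s (H t) - Xfield \<psi> \<alpha> e s (H s)\<bar> \<le> B * \<bar>H t - H s\<bar>"
      by (rule B2) (use t s inL Hv in auto)
    also have "\<dots> \<le> B * (\<bar>K\<bar> * \<bar>t - s\<bar> powr \<gamma>H)"
    proof (intro mult_left_mono B)
      have "K * \<bar>t - s\<bar> powr \<gamma>H \<le> \<bar>K\<bar> * \<bar>t - s\<bar> powr \<gamma>H" by (intro mult_right_mono) auto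
      then show "\<bar>H t - H s\<bar> \<le> \<bar>K\<bar> * \<bar>t - s\<bar> powr \<gamma>H" using K[OF t s ts] by linarith
    qed
    also have "\<dots> \<le> B * (\<bar>K\<bar> * (M * \<bar>t - s\<bar> powr \<mu>))"
      by (intro mult_left_mono pow h B) (use assms(9) in \<open>auto simp: \<mu>_def\<close>)
    finally have 2: "\<bar>Xfield \<psi> \<alpha> e s (H t) - Xfield \<psi> \<alpha> e s (H s)\<bar> \<le> B * (\<bar>K\<bar> * (M * \<bar>t - s\<bar> powr \<mu>))" .
    have "\<bar>LMSM \<psi> \<alpha> e H t - LMSM \<psi> \<alpha> e H s\<bar> \<le> B * (M * \<bar>t - s\<bar> powr \<mu>) + B * (\<bar>K\<bar> * (M * \<bar>t - s\<bar> powr \<mu>))"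
      using 1 2 unfolding LMSM_def by linarith
    also have "\<dots> = (B * M + B * \<bar>K\<bar> * M) * \<bar>t - s\<bar> powr \<mu>" by (simp add: algebra_simps)
    finally show ?thesis .
  qed
  then show ?thesis unfolding inf \<mu>_def by blast
qed

end
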